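(* (Multiple Grunsky inequality.) Let $\tau>0$ and consider univalent functions $$f_1:e^{-2\pi\tau}\mathbb D\to D_1,\qquad f_A:\mathbb A_\tau\to A,\qquad f_2:\mathbb D^*\to D_2$$ onto domains $D_1,A,D_2\subset\hat{\mathbb C}$ such that $D_1$, $A$ and $D_2$ are disjoint, $f_1(0)=0$ and $f_2(\infty)=\infty$, and such that the annulus $A$ separates $D_1$ from $D_2$, with the inner boundary $e^{-2\pi\tau}S^1$ of $\mathbb A_\tau$ corresponding under $f_A$ to the boundary component of $A$ facing $D_1$ and $S^1$ to the one facing $D_2$. Then $$\iint_{e^{-2\pi\tau}\mathbb D}\left|\frac{f_1'(z)}{f_1(z)}-\frac1z\right|^2|dz|^2+\iint_{\mathbb A_\tau}\left|\frac{f_A'(z)}{f_A(z)}-\frac1z\right|^2|dz|^2+\iint_{\mathbb D^*}\left|\frac{f_2'(z)}{f_2(z)}-\frac1z\right|^2|dz|^2\le 2\pi\log\left|\frac{f_2'(\infty)}{f_1'(0)}\right|.$$ Equality holds if and only if $\hat{\mathbb C}\setminus(D_1\cup A\cup D_2)$ has measure zero.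
   Context: $\hat{\mathbb C}$ is the Riemann sphere, $\mathbb D=\{|z|<1\}$, $S^1=\partial\mathbb D$, $\mathbb D^*=\{|z|>1\}\cup\{\infty\}$, $\mathbb A_\tau=\{z\in\mathbb C:e^{-2\pi\tau}<|z|<1\}$. Univalent means injective holomorphic (as maps into $\hat{\mathbb C}$; $f_2$ has a simple pole at $\infty$). $f_2'(\infty)=\lim_{z\to\infty}f_2(z)/z$. $|dz|^2$ denotes Lebesgue area measure. *)

theory Defs
  imports "HOL-Complex_Analysis.Complex_Analysis"
begin

text \<open>The point \<open>\<infinity>\<close> is \<^term>\<open>None\<close>, and \<^term>\<open>Some\<close> embeds the complex plane.\<close>

definition riemann_sphere :: "complex option topology" where
  "riemann_sphere = Alexandroff_compactification euclidean"

definition annulus :: "real \<Rightarrow> complex set" where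
  "annulus \<tau> = {z. exp (- 2 * pi * \<tau>) < cmod z \<and> cmod z < 1}"

text \<open>The finite part of \<open>\<D>\<^sup>*\<close>, that is \<open>\<D>\<^sup>*\<close> without the point \<open>\<infinity>\<close>.\<close>

definition exterior_disc :: "complex set" where
  "exterior_disc = {z. 1 < cmod z}"

definition univalent_on :: "(complex \<Rightarrow> complex) \<Rightarrow> complex set \<Rightarrow> bool" where
  "univalent_on f S \<longleftrightarrow> f holomorphic_on S \<and> inj_on f S"

text \<open>
  A univalent map of \<open>\<D>\<^sup>*\<close> into the Riemann sphere fixing \<open>\<infinity>\<close> is finite on the finite part of its
  domain, so it is represented by its restriction to that part. That restriction has a limit
  \<open>\<infinity>\<close> at \<open>\<infinity>\<close>; holomorphy of the extension at \<open>\<infinity>\<close> and simplicity of the pole are then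
  consequences (removable singularities, injectivity) and are not assumed separately.
\<close>

definition univalent_exterior :: "(complex \<Rightarrow> complex) \<Rightarrow> bool" where
  "univalent_exterior f \<longleftrightarrow> univalent_on f exterior_disc \<and> filterlim f at_infinity at_infinity"

definition deriv_infinity :: "(complex \<Rightarrow> complex) \<Rightarrow> complex" where
  "deriv_infinity f = Lim at_infinity (\<lambda>z. f z / z)"

definition complementary_components :: "complex option set \<Rightarrow> complex option set set" where
  "complementary_components A =
     connected_components_of (subtopology riemann_sphere (topspace riemann_sphere - A))"

definition separates :: "complex option set \<Rightarrow> complex option set \<Rightarrow> complex option set \<Rightarrow> bool" where
  "separates A D E \<longleftrightarrow>
     (\<exists>K\<in>complementary_components A. \<exists>L\<in>complementary_components A.
        K \<noteq> L \<and> D \<subseteq> K \<and> E \<subseteq> L)"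

definition boundary_component_facing ::
    "complex option set \<Rightarrow> complex option set \<Rightarrow> complex option set \<Rightarrow> bool" where
  "boundary_component_facing A D B \<longleftrightarrow>
     B \<in> connected_components_of (subtopology riemann_sphere (riemann_sphere frontier_of A)) \<and>
     (\<exists>K\<in>complementary_components A. D \<subseteq> K \<and> B \<subseteq> K)"

text \<open>
  The subset of the sphere corresponding under \<open>f\<close> to a part \<open>E\<close> of the boundary of \<open>S\<close>: since
  \<open>f\<close> need not extend continuously to \<open>E\<close>, this is the set of all limit points of \<open>f z\<close> as
  \<open>z \<in> S\<close> approaches \<open>E\<close>.
\<close>

definition cluster_set :: "(complex \<Rightarrow> complex) \<Rightarrow> complex set \<Rightarrow> complex set \<Rightarrow> complex option set" where
  "cluster_set f S E =
     (\<Inter>\<epsilon>\<in>{0<..}. riemann_sphere closure_of (Some ` f ` {z \<in> S. infdist z E < \<epsilon>}))"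

definition log_deriv_defect :: "(complex \<Rightarrow> complex) \<Rightarrow> complex \<Rightarrow> real" where
  "log_deriv_defect f z = (cmod (deriv f z / f z - 1 / z))\<^sup>2"

end

theory Submission
  imports Defs "HOL-Real_Asymp.Real_Asymp"
begin

text \<open>
  The measure \<open>|dw|\<^sup>2 / |w|\<^sup>2\<close> gives a round annulus of radii \<open>a < b\<close> the area \<open>2 \<pi> ln (b / a)\<close>.
  Expanding \<open>|f'/f - 1/z|\<^sup>2\<close> on a round annulus, the first term integrates to the logarithmic area of
  the image, and the cross term only sees the winding number of the image circles about 0. If that
  number is 1, the integral is the logarithmic area of the image minus that of the annulus.
  For the discs around 0 and \<open>\<infinity>\<close> a small concentric disc is removed and shrunk, which brings in
  \<open>f\<^sub>1'(0)\<close> and \<open>f\<^sub>2'(\<infinity>)\<close>. Summing up, the defect in the inequality is exactly the logarithmic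
  area of the complement of \<open>D\<^sub>1 \<union> A \<union> D\<^sub>2\<close>.

  That \<open>f\<^sub>A\<close> winds once around 0: the winding number about \<open>f\<^sub>A(\<zeta>)\<close> of the image of a circle drops
  by 1 as \<open>\<zeta>\<close> crosses the circle outwards. Near the inner boundary it agrees with the winding
  number about 0, near the outer boundary with that about \<open>\<infinity>\<close>, which is 0.
\<close>

text \<open>Since \<open>D\<^sub>1\<close> contains 0 and \<open>D\<^sub>2\<close> contains
  infinity, both have infinite logarithmic area, so the areas cannot simply be added. Two radii
  \<open>s\<close> and \<open>R\<close> are therefore fixed, with the closed disc of radius
  \<open>s\<close> inside the finite domain around 0 and all finite points of modulus at least
  \<open>R\<close> inside the domain around infinity. All areas are compared within the round
  annulus between these radii, and in the final sum of logarithms the auxiliary radii cancel.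

  The boundaries of the three domains may be arbitrarily wild, which rules out Stokes' formula along
  them. The area terms come from a change of variables on open sets instead, and the cross term from
  circles in the interior. In the same way \<open>f\<^sub>A\<close> has cluster sets in place of
  boundary values, so winding numbers near the boundary are read off at interior points close to
  it.\<close>

section \<open>Holomorphic change of variables\<close>

text \<open>The substitution theorem \<open>has_absolute_integral_change_of_variables\<close> is
  about maps of \<open>real^'n\<close> and the determinant of their derivative, so the plane is
  transported to \<open>real^2\<close> and back.\<close>

definition cplx_of_vec :: "real^2 \<Rightarrow> complex" where
  "cplx_of_vec v = Complex (v $ 1) (v $ 2)"

definition vec_of_cplx :: "complex \<Rightarrow> real^2" where
  "vec_of_cplx z = vector [Re z, Im z]"

lemma cplx_of_vec_of_cplx [simp]: "cplx_of_vec (vec_of_cplx z) = z"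
  by (simp add: cplx_of_vec_def vec_of_cplx_def)

lemma vec_of_cplx_of_vec [simp]: "vec_of_cplx (cplx_of_vec v) = v"
  by (simp add: cplx_of_vec_def vec_of_cplx_def vec_eq_iff forall_2)

lemma bounded_linear_cplx_of_vec: "bounded_linear cplx_of_vec"
  unfolding cplx_of_vec_def linear_conv_bounded_linear[symmetric]
  by (rule linearI) (auto simp: complex_eq_iff)

lemma bounded_linear_vec_of_cplx: "bounded_linear vec_of_cplx"
  unfolding vec_of_cplx_def linear_conv_bounded_linear[symmetric]
  by (rule linearI) (auto simp: vec_eq_iff forall_2)

lemma measurable_cplx_of_vec [measurable]: "cplx_of_vec \<in> borel_measurable borel"
  by (intro borel_measurable_continuous_onI linear_continuous_on bounded_linear_cplx_of_vec)

lemma lborel_complex_eq_distr_vec: "(lborel :: complex measure) = distr lborel borel cplx_of_vec"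
proof (rule lborel_eqI)
  fix l u :: complex
  assume le: "\<And>b. b \<in> Basis \<Longrightarrow> l \<bullet> b \<le> u \<bullet> b"
  have "cplx_of_vec -` box l u = box (vec_of_cplx l) (vec_of_cplx u)"
    by (auto simp: mem_box cplx_of_vec_def vec_of_cplx_def Basis_complex_def Basis_vec_def
        forall_2 inner_axis)
  moreover have "(\<Prod>b\<in>Basis. (vec_of_cplx u - vec_of_cplx l) \<bullet> b) = (\<Prod>b\<in>Basis. (u - l) \<bullet> b)"
    by (simp add: Basis_complex_def Basis_vec_def vec_of_cplx_def UNIV_2 inner_axis axis_eq_axis)
  moreover have "\<And>b. b \<in> Basis \<Longrightarrow> vec_of_cplx l \<bullet> b \<le> vec_of_cplx u \<bullet> b"
    using le[of 1] le[of \<i>]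
    by (auto simp: Basis_complex_def Basis_vec_def vec_of_cplx_def UNIV_2 inner_axis)
  ultimately show "emeasure (distr lborel borel cplx_of_vec) (box l u) = (\<Prod>b\<in>Basis. (u - l) \<bullet> b)"
    by (simp add: emeasure_distr)
qed simp

text \<open>Gives access to Fubini in the variables Re and Im, needed on the strip that
  \<open>exp\<close> maps to an annulus.\<close>

lemma lborel_complex_eq_distr_prod:
  "(lborel :: complex measure) = distr (lborel \<Otimes>\<^sub>M lborel) borel (\<lambda>(x, y). Complex x y)"
proof (rule lborel_eqI)
  fix l u :: complex
  assume le: "\<And>b. b \<in> Basis \<Longrightarrow> l \<bullet> b \<le> u \<bullet> b"
  have [measurable]: "(\<lambda>(x, y). Complex x y) \<in> borel_measurable (lborel \<Otimes>\<^sub>M lborel)"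
    unfolding lborel_prod case_prod_beta measurable_lborel2
    by (simp add: borel_measurable_complex_iff borel_measurable_continuous_onI continuous_intros)
  have "(\<lambda>(x, y). Complex x y) -` box l u = box (Re l) (Re u) \<times> box (Im l) (Im u)"
    by (auto simp: mem_box Basis_complex_def)
  then show "emeasure (distr (lborel \<Otimes>\<^sub>M lborel) borel (\<lambda>(x, y). Complex x y)) (box l u)
      = (\<Prod>b\<in>Basis. (u - l) \<bullet> b)"
    using le[of 1] le[of \<i>]
    by (simp add: emeasure_distr space_pair_measure lborel.emeasure_pair_measure_Times
        Basis_complex_def ennreal_mult)
qed simp

text \<open>A dictionary for the substitution theorem, which speaks of absolute integrability of
  vector-valued functions: hence the wrapping \<open>vec\<close> into \<open>real^1\<close>.
  Continuity on a Borel set gives Borel measurability, so that \<open>lborel\<close> and its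
  completion \<open>lebesgue\<close> yield the same integral.\<close>

lemma set_integral_complex_vec:
  fixes h :: "complex \<Rightarrow> real"
  assumes "S \<in> sets borel" "continuous_on S h"
  shows "set_integrable lborel S h \<longleftrightarrow>
           (\<lambda>v. vec (h (cplx_of_vec v)) :: real^1) absolutely_integrable_on (cplx_of_vec -` S)" (is ?A)
    and "set_integrable lborel S h \<Longrightarrow>
           integral (cplx_of_vec -` S) (\<lambda>v. vec (h (cplx_of_vec v)) :: real^1) = vec (LINT z:S|lborel. h z)" (is "_ \<Longrightarrow> ?B")
proof -
  have m [measurable]: "(\<lambda>z. indicator S z *\<^sub>R h z) \<in> borel_measurable borel"
    using assms by (intro borel_measurable_continuous_on_indicator)
  have m2: "(\<lambda>v. indicator (cplx_of_vec -` S) v *\<^sub>R h (cplx_of_vec v)) \<in> borel_measurable borel"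
    using measurable_compose[OF measurable_cplx_of_vec m]
    by (simp add: indicator_def)
  have eq: "(\<lambda>v. indicator (cplx_of_vec -` S) v *\<^sub>R h (cplx_of_vec v))
      = (\<lambda>v. indicator S (cplx_of_vec v) *\<^sub>R h (cplx_of_vec v))"
    by (auto simp: indicator_def)
  have "set_integrable lborel S h \<longleftrightarrow> integrable (distr lborel borel cplx_of_vec) (\<lambda>z. indicator S z *\<^sub>R h z)"
    unfolding set_integrable_def lborel_complex_eq_distr_vec[symmetric] ..
  also have "\<dots> \<longleftrightarrow> integrable lborel (\<lambda>v. indicator (cplx_of_vec -` S) v *\<^sub>R h (cplx_of_vec v))"
    unfolding eq using m by (subst integrable_distr_eq) simp_all
  also have "\<dots> \<longleftrightarrow> (\<lambda>v. h (cplx_of_vec v)) absolutely_integrable_on (cplx_of_vec -` S)"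
    unfolding set_integrable_def using m2 by (intro integrable_completion[symmetric]) auto
  finally have 1: "set_integrable lborel S h \<longleftrightarrow> (\<lambda>v. h (cplx_of_vec v)) absolutely_integrable_on (cplx_of_vec -` S)" .
  then show ?A
    by (simp add: absolutely_integrable_on_1_iff)
  assume "set_integrable lborel S h"
  with 1 have int: "(\<lambda>v. h (cplx_of_vec v)) absolutely_integrable_on (cplx_of_vec -` S)" by simp
  have "integral (cplx_of_vec -` S) (\<lambda>v. h (cplx_of_vec v)) = (LINT v:cplx_of_vec -` S|lebesgue. h (cplx_of_vec v))"
    using int by (simp add: set_lebesgue_integral_eq_integral)
  also have "\<dots> = integral\<^sup>L lborel (\<lambda>v. indicator (cplx_of_vec -` S) v *\<^sub>R h (cplx_of_vec v))"
    unfolding set_lebesgue_integral_def using m2 by (intro integral_completion) auto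
  also have "\<dots> = integral\<^sup>L (distr lborel borel cplx_of_vec) (\<lambda>z. indicator S z *\<^sub>R h z)"
    unfolding eq using m by (subst integral_distr) simp_all
  also have "\<dots> = (LINT z:S|lborel. h z)"
    unfolding set_lebesgue_integral_def lborel_complex_eq_distr_vec[symmetric] ..
  finally show ?B
    using int by (simp add: integral_on_1_eq absolutely_integrable_on_def integrable_on_1_iff)
qed

text \<open>By the Cauchy-Riemann equations the Jacobian of a holomorphic map is |f'|^2.
  Integrability is an equivalence, so that finite logarithmic area of the image makes |f'/f|^2
  integrable on the domain.\<close>

lemma
  fixes k :: "complex \<Rightarrow> real"
  assumes "open S" and f: "f holomorphic_on S" and inj: "inj_on f S" and k: "continuous_on (f ` S) k"
  shows set_integrable_holomorphic_image:
      "set_integrable lborel (f ` S) k \<longleftrightarrow> set_integrable lborel S (\<lambda>z. (cmod (deriv f z))\<^sup>2 * k (f z))"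
    and set_integral_holomorphic_image:
      "(LINT w:f ` S|lborel. k w) = (LINT z:S|lborel. (cmod (deriv f z))\<^sup>2 * k (f z))"
proof -
  let ?p = cplx_of_vec and ?q = vec_of_cplx
  let ?g = "\<lambda>v. ?q (f (?p v))" and ?g' = "\<lambda>v h. ?q (deriv f (?p v) * ?p h)"
  let ?S = "?p -` S"
  let ?h = "\<lambda>z. (cmod (deriv f z))\<^sup>2 * k (f z)"
  let ?kk = "\<lambda>v. vec (k (?p v)) :: real^1"
  have ofS: "open (f ` S)"
    using open_mapping_thm3 assms by blast
  have oS: "open ?S"
    using \<open>open S\<close> by (intro open_vimage linear_continuous_on bounded_linear_cplx_of_vec)
  have gS: "?g ` ?S = ?p -` (f ` S)"
  proof -
    have "v \<in> ?g ` ?S" if "?p v = f z" "z \<in> S" for v z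
      using that by (intro image_eqI[of _ _ "?q z"]) (auto simp flip: that(1))
    then show ?thesis by auto
  qed
  have ch: "continuous_on S ?h"
    using f k \<open>open S\<close>
    by (intro continuous_intros continuous_on_compose2[OF k] holomorphic_on_imp_continuous_on
        holomorphic_deriv) auto
  have der: "(?g has_derivative ?g' v) (at v within ?S)" if "v \<in> ?S" for v
  proof -
    have "(f has_derivative (\<lambda>h. deriv f (?p v) * h)) (at (?p v))"
      using holomorphic_derivI[OF f \<open>open S\<close>, of "?p v" UNIV] that
      by (simp add: has_field_derivative_def)
    from has_derivative_compose[OF bounded_linear_imp_has_derivative[OF bounded_linear_cplx_of_vec] this]
    have "((\<lambda>v. f (?p v)) has_derivative (\<lambda>h. deriv f (?p v) * ?p h)) (at v within ?S)" .
    from bounded_linear.has_derivative[OF bounded_linear_vec_of_cplx this]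
    show ?thesis .
  qed
  \<comment> \<open>Multiplication by x + i y has the matrix with rows (x, -y) and (y, x), of
    determinant x^2 + y^2.\<close>
  have detg: "\<bar>det (matrix (?g' v))\<bar> = (cmod (deriv f (?p v)))\<^sup>2" for v
    by (simp add: det_2 matrix_def cplx_of_vec_def vec_of_cplx_def axis_def cmod_power2
        flip: power2_eq_square)
  have injg: "inj_on ?g ?S"
  proof (rule inj_onI)
    fix x y assume "x \<in> ?S" "y \<in> ?S" "?g x = ?g y"
    then have "?p (?g x) = ?p (?g y)" by simp
    then have "?p x = ?p y" using \<open>x \<in> ?S\<close> \<open>y \<in> ?S\<close> inj by (simp add: inj_on_eq_iff)
    then have "?q (?p x) = ?q (?p y)" by simp
    then show "x = y" by simp
  qed
  \<comment> \<open>The value \<open>b\<close> is arbitrary because the substitution theorem couples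
    integrability with a given value; choosing one side's integral for \<open>b\<close> separates
    the two.\<close>
  have cov: "(\<lambda>v. vec (?h (?p v)) :: real^1) absolutely_integrable_on ?S \<and>
           integral ?S (\<lambda>v. vec (?h (?p v)) :: real^1) = b
     \<longleftrightarrow> ?kk absolutely_integrable_on (?p -` (f ` S)) \<and> integral (?p -` (f ` S)) ?kk = b" for b
  proof -
    have "\<bar>det (matrix (?g' v))\<bar> *\<^sub>R vec (k (?p (?g v))) = (vec (?h (?p v)) :: real^1)" for v
      unfolding detg by (simp add: vec_eq_iff)
    then show ?thesis
      using has_absolute_integral_change_of_variables[OF _ der injg, of ?kk b] oS
      by (simp add: gS borel_open)
  qed
  have ofS': "f ` S \<in> sets borel" "S \<in> sets borel"
    using ofS \<open>open S\<close> by auto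
  note iff = set_integral_complex_vec(1)[OF ofS'(1) k] set_integral_complex_vec(1)[OF ofS'(2) ch]
  show 1: "set_integrable lborel (f ` S) k \<longleftrightarrow> set_integrable lborel S ?h"
    unfolding iff using cov by blast
  show "(LINT w:f ` S|lborel. k w) = (LINT z:S|lborel. ?h z)"
  proof (cases "set_integrable lborel S ?h")
    case True
    note int = set_integral_complex_vec(2)[OF ofS'(2) ch True]
    have int2: "integral (?p -` (f ` S)) ?kk = vec (LINT w:f ` S|lborel. k w)"
      using set_integral_complex_vec(2)[OF ofS'(1) k] True 1 by blast
    have "integral (?p -` (f ` S)) ?kk = integral ?S (\<lambda>v. vec (?h (?p v)) :: real^1)"
      using cov True unfolding iff by blast
    then have "(vec (LINT w:f ` S|lborel. k w) :: real^1) = vec (LINT z:S|lborel. ?h z)"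
      unfolding int int2 .
    then show ?thesis
      by (simp add: vec_eq_iff)
  next
    \<comment> \<open>Both sides are then 0, the default integral of a function that is not
      integrable.\<close>
    case False
    with 1 show ?thesis
      by (simp add: set_lebesgue_integral_def set_integrable_def not_integrable_integral_eq)
  qed
qed

section \<open>Logarithmic area and annuli\<close>

definition open_annulus :: "real \<Rightarrow> real \<Rightarrow> complex set" where
  "open_annulus a b = {z. a < cmod z \<and> cmod z < b}"

text \<open>Area in the metric |dw| / |w|. A Borel set of infinite logarithmic area gets the default
  value 0, hence the integrability facts that accompany the use of this function.\<close>

definition log_area :: "complex set \<Rightarrow> real" where
  "log_area S = (LINT w:S|lborel. 1 / (cmod w)\<^sup>2)"

lemma open_open_annulus [simp]: "open (open_annulus a b)"
  unfolding open_annulus_def by (intro open_Collect_conj open_Collect_less continuous_intros)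

lemma open_annulus_measurable [measurable, simp]: "open_annulus a b \<in> sets borel"
  by (rule borel_open) simp

lemma null_sets_real_axis: "{z::complex. Im z = 0} \<in> null_sets lborel"
proof -
  have "closed {z::complex. Im z = 0}"
    by (intro closed_Collect_eq continuous_intros)
  moreover have "negligible {z::complex. \<i> \<bullet> z = 0}"
    by (rule negligible_hyperplane) simp
  then have "{z::complex. Im z = 0} \<in> null_sets lebesgue"
    by (simp add: negligible_iff_null_sets)
  ultimately show ?thesis
    by (metis borel_closed null_sets_completion_iff sets_lborel)
qed

lemma set_integral_Complex_Times:
  fixes h :: "complex \<Rightarrow> real"
  assumes int: "set_integrable lborel {z. Re z \<in> I \<and> Im z \<in> J} h"
  shows "(LINT z:{z. Re z \<in> I \<and> Im z \<in> J}|lborel. h z) = (LINT x:I|lborel. LINT y:J|lborel. h (Complex x y))"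
proof -
  let ?S = "{z. Re z \<in> I \<and> Im z \<in> J}"
  let ?C = "\<lambda>(x, y). Complex x y"
  have m: "?C \<in> measurable (lborel \<Otimes>\<^sub>M lborel) borel"
    unfolding lborel_prod case_prod_beta measurable_lborel2
    by (simp add: borel_measurable_complex_iff borel_measurable_continuous_onI continuous_intros)
  have int': "integrable (distr (lborel \<Otimes>\<^sub>M lborel) borel ?C) (\<lambda>z. indicator ?S z *\<^sub>R h z)"
    using int unfolding set_integrable_def lborel_complex_eq_distr_prod[symmetric] .
  then have m2: "(\<lambda>z. indicator ?S z *\<^sub>R h z) \<in> borel_measurable borel"
    using borel_measurable_integrable by fastforce
  have eq: "indicator ?S (?C p) *\<^sub>R h (?C p)
      = (case p of (x, y) \<Rightarrow> indicator I x *\<^sub>R indicator J y *\<^sub>R h (Complex x y))" for p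
    by (auto simp: indicator_def split: prod.splits)
  have int2: "integrable (lborel \<Otimes>\<^sub>M lborel) (\<lambda>p. case p of (x, y) \<Rightarrow> indicator I x *\<^sub>R indicator J y *\<^sub>R h (Complex x y))"
    using integrable_distr[OF m int'] unfolding eq .
  have "(LINT z:?S|lborel. h z) = integral\<^sup>L (distr (lborel \<Otimes>\<^sub>M lborel) borel ?C) (\<lambda>z. indicator ?S z *\<^sub>R h z)"
    unfolding set_lebesgue_integral_def lborel_complex_eq_distr_prod[symmetric] ..
  also have "\<dots> = integral\<^sup>L (lborel \<Otimes>\<^sub>M lborel) (\<lambda>p. indicator ?S (?C p) *\<^sub>R h (?C p))"
    by (rule integral_distr[OF m m2])
  also have "\<dots> = (\<integral>x. (\<integral>y. indicator I x *\<^sub>R indicator J y *\<^sub>R h (Complex x y) \<partial>lborel) \<partial>lborel)"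
    unfolding eq lborel_pair.integral_fst'[OF int2, symmetric] by simp
  also have "\<dots> = (LINT x:I|lborel. LINT y:J|lborel. h (Complex x y))"
    by (simp add: set_lebesgue_integral_def)
  finally show ?thesis .
qed

lemma has_integral_imp_LINT_Ioo:
  fixes g :: "real \<Rightarrow> real"
  assumes "(g has_integral c) {a..b}" "continuous_on {a..b} g"
  shows "(LINT y:{a<..<b}|lborel. g y) = c"
proof -
  have "set_integrable lborel {a..b} g"
    unfolding set_integrable_def by (intro borel_integrable_compact assms compact_Icc)
  then have "set_integrable lborel {a<..<b} g"
    by (rule set_integrable_subset) auto
  then have "(LINT y:{a<..<b}|lborel. g y) = integral {a<..<b} g"
    by (rule set_borel_integral_eq_integral)
  also have "\<dots> = c"
    using assms(1) by (intro integral_unique) (simp add: has_integral_Icc_iff_Ioo)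
  finally show ?thesis .
qed

text \<open>Logarithmic polar coordinates: under z = exp (x + i y) the density 1 / |z|^2 cancels the
  Jacobian, so \<open>k\<close> is integrated over a rectangle of width ln (b / a) and height 2 pi.
  The inner integral over each circle is the constant \<open>c\<close>.\<close>

lemma set_integral_annulus_circle_mean:
  fixes k :: "complex \<Rightarrow> real"
  assumes "0 < a" "a < b" and k: "continuous_on (open_annulus a b) k"
    and int: "set_integrable lborel (open_annulus a b) (\<lambda>z. k z / (cmod z)\<^sup>2)"
    and mean: "\<And>r. a < r \<Longrightarrow> r < b \<Longrightarrow> ((\<lambda>t. k (of_real r * cis t)) has_integral c) {0..2*pi}"
  shows "(LINT z:open_annulus a b|lborel. k z / (cmod z)\<^sup>2) = c * ln (b / a)"
proof -
  let ?A = "open_annulus a b"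
  \<comment> \<open>On this strip \<open>exp\<close> is injective, and its image is the annulus
    without the points on the positive real axis, a null set.\<close>
  define S where "S = {z. Re z \<in> {ln a<..<ln b} \<and> Im z \<in> {0<..<2*pi}}"
  have oS: "open S"
    unfolding S_def greaterThanLessThan_iff
    by (intro open_Collect_conj open_Collect_less continuous_intros)
  have bd: "a < exp x \<and> exp x < b" if "ln a < x" "x < ln b" for x
    using that exp_less_mono[of "ln a" x] exp_less_mono[of x "ln b"] assms(1,2) by simp
  have inj: "inj_on exp S"
  proof (rule inj_onI)
    fix x y assume xy: "x \<in> S" "y \<in> S" "exp x = exp y"
    have "\<bar>Im x - Im y\<bar> < 2 * pi"
      using xy(1,2) unfolding S_def mem_Collect_eq greaterThanLessThan_iff by linarith
    then show "x = y" using xy(3) by (rule exp_complex_eqI)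
  qed
  have eS: "exp ` S \<subseteq> ?A"
    using bd by (auto simp: S_def open_annulus_def)
  have Ae: "?A - {z. Im z = 0} \<subseteq> exp ` S"
  proof
    fix z assume z: "z \<in> ?A - {z. Im z = 0}"
    then have "z \<noteq> 0" by auto
    have nn: "-z \<notin> \<real>\<^sub>\<le>\<^sub>0" using z by (auto simp: complex_nonpos_Reals_iff)
    \<comment> \<open>The branch of the logarithm with imaginary part between 0 and 2 pi.\<close>
    have "exp (Ln (-z) + \<i> * pi) = z"
      using \<open>z \<noteq> 0\<close> by (simp add: exp_add)
    moreover have "Ln (-z) + \<i> * pi \<in> S"
      using z nn \<open>z \<noteq> 0\<close> mpi_less_Im_Ln[of "-z"] Im_Ln_less_pi[of "-z"] assms(1,2)
      by (auto simp: S_def open_annulus_def complex_nonpos_Reals_iff ln_less_cancel_iff)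
    ultimately show "z \<in> exp ` S" by (metis imageI)
  qed
  have m [measurable]: "exp ` S \<in> sets borel"
    using open_mapping_thm3[OF holomorphic_on_exp oS inj] by auto
  have k': "continuous_on (exp ` S) (\<lambda>z. k z / (cmod z)\<^sup>2)"
    using eS by (intro continuous_intros continuous_on_subset[OF k]) auto
  have eqk: "(cmod (deriv exp z))\<^sup>2 * (k (exp z) / (cmod (exp z))\<^sup>2) = k (exp z)" for z :: complex
    by (simp add: DERIV_imp_deriv[OF DERIV_exp])
  have intS: "set_integrable lborel S (\<lambda>z. k (exp z))"
    using set_integrable_holomorphic_image[OF oS holomorphic_on_exp inj k'] set_integrable_subset[OF int _ eS] m
    unfolding eqk by simp
  have "(LINT z:?A|lborel. k z / (cmod z)\<^sup>2) = (LINT z:exp ` S|lborel. k z / (cmod z)\<^sup>2)"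
  proof -
    \<comment> \<open>The indicator inside the integrand makes it integrable on the whole plane, as
      \<open>set_integral_null_delta\<close> demands.\<close>
    have "(LINT z:?A|lborel. indicator ?A z *\<^sub>R (k z / (cmod z)\<^sup>2)) = (LINT z:exp ` S|lborel. indicator ?A z *\<^sub>R (k z / (cmod z)\<^sup>2))"
    proof (rule set_integral_null_delta)
      show "integrable lborel (\<lambda>z. indicat_real (open_annulus a b) z *\<^sub>R (k z / (cmod z)\<^sup>2))"
        using int unfolding set_integrable_def .
      have "(?A - exp ` S) \<union> (exp ` S - ?A) \<subseteq> {z. Im z = 0}"
        using Ae eS by auto
      then show "(?A - exp ` S) \<union> (exp ` S - ?A) \<in> null_sets lborel"
        using null_sets_real_axis m by (rule_tac null_sets_subset) auto
    qed (use m in auto)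
    moreover have "(LINT z:?A|lborel. indicator ?A z *\<^sub>R (k z / (cmod z)\<^sup>2)) = (LINT z:?A|lborel. k z / (cmod z)\<^sup>2)"
      by (rule set_lebesgue_integral_cong) auto
    moreover have "(LINT z:exp ` S|lborel. indicator ?A z *\<^sub>R (k z / (cmod z)\<^sup>2)) = (LINT z:exp ` S|lborel. k z / (cmod z)\<^sup>2)"
      by (rule set_lebesgue_integral_cong) (use eS m in auto)
    ultimately show ?thesis by simp
  qed
  also have "\<dots> = (LINT z:S|lborel. k (exp z))"
    using set_integral_holomorphic_image[OF oS holomorphic_on_exp inj k'] unfolding eqk .
  also have "\<dots> = (LINT x:{ln a<..<ln b}|lborel. LINT y:{0<..<2*pi}|lborel. k (exp (Complex x y)))"
    using intS unfolding S_def by (rule set_integral_Complex_Times)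
  also have "\<dots> = (LINT x:{ln a<..<ln b}|lborel. c)"
  proof (rule set_lebesgue_integral_cong)
    show "\<forall>x. x \<in> {ln a<..<ln b} \<longrightarrow> (LINT y:{0<..<2*pi}|lborel. k (exp (Complex x y))) = c"
    proof (intro allI impI)
      fix x assume "x \<in> {ln a<..<ln b}"
      then have x: "a < exp x" "exp x < b" using bd by auto
      have e: "exp (Complex x y) = of_real (exp x) * cis y" for y
        by (simp add: exp_eq_polar)
      show "(LINT y:{0<..<2*pi}|lborel. k (exp (Complex x y))) = c"
        unfolding e
      proof (rule has_integral_imp_LINT_Ioo[OF mean[OF x]])
        show "continuous_on {0..2 * pi} (\<lambda>xa. k (complex_of_real (exp x) * cis xa))"
          using x by (intro continuous_on_compose2[OF k] continuous_intros)
             (auto simp: open_annulus_def norm_mult)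
      qed
    qed
  qed simp
  also have "\<dots> = c * ln (b / a)"
    using assms by (simp add: set_integral_const ln_div set_lebesgue_integral_def)
  finally show ?thesis .
qed

lemma set_integrable_inverse_square:
  assumes "bounded S" "S \<in> sets borel" "0 < e" "\<And>z. z \<in> S \<Longrightarrow> e \<le> cmod z"
  shows "set_integrable lborel S (\<lambda>z. 1 / (cmod z)\<^sup>2)"
proof -
  obtain R where R: "\<And>z. z \<in> S \<Longrightarrow> cmod z \<le> R" using assms(1) bounded_iff by blast
  let ?K = "cball 0 R - ball (0::complex) e"
  have "set_integrable lborel ?K (\<lambda>z. 1 / (cmod z)\<^sup>2)"
    unfolding set_integrable_def using assms(3)
    by (intro borel_integrable_compact compact_diff continuous_intros) auto
  then show ?thesis
    by (rule set_integrable_subset) (use assms(2,4) R in \<open>force simp: dist_norm not_less\<close>)+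
qed

lemma log_area_annulus:
  assumes "0 < a" "a < b"
  shows "log_area (open_annulus a b) = 2 * pi * ln (b / a)"
proof -
  have "set_integrable lborel (open_annulus a b) (\<lambda>z. 1 / (cmod z)\<^sup>2)"
    by (rule set_integrable_inverse_square[of _ a])
      (use assms in \<open>auto simp: open_annulus_def intro!: boundedI[of _ b]\<close>)
  then show ?thesis
    unfolding log_area_def using assms has_integral_const_real[of "1::real" 0 "2*pi"]
    by (intro set_integral_annulus_circle_mean) auto
qed

text \<open>The cross term is put in the form k / |z|^2 so that
  \<open>set_integral_annulus_circle_mean\<close> applies to it.\<close>

lemma cmod_diff_inverse_square:
  assumes "z \<noteq> 0"
  shows "(cmod (h - 1 / z))\<^sup>2 = (cmod h)\<^sup>2 + 1 / (cmod z)\<^sup>2 - 2 * (Re (z * h) / (cmod z)\<^sup>2)"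
proof -
  have "(cmod z)\<^sup>2 * (cmod (h - 1 / z))\<^sup>2 = (cmod (z * h - 1))\<^sup>2"
    using assms by (simp add: algebra_simps flip: power_mult_distrib norm_mult)
  also have "\<dots> = (cmod z)\<^sup>2 * (cmod h)\<^sup>2 + 1 - 2 * Re (z * h)"
    by (simp only: cmod_power2 flip: power_mult_distrib norm_mult)
      (simp add: power2_eq_square algebra_simps)
  finally have "(cmod (h - 1 / z))\<^sup>2
      = ((cmod z)\<^sup>2 * (cmod h)\<^sup>2 + 1 - 2 * Re (z * h)) / (cmod z)\<^sup>2"
    using assms by (metis mult.commute norm_eq_zero nonzero_eq_divide_eq power_not_zero)
  then show ?thesis
    using assms by (simp add: add_divide_distrib diff_divide_distrib)
qed

text \<open>On the circle dz = i z dt, so Re (z h) dt is the imaginary part of h dz.\<close>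

lemma has_integral_Re_contour_integral_circlepath:
  assumes "(h has_contour_integral 2 * pi * \<i>) (circlepath 0 r)"
  shows "((\<lambda>t. Re (of_real r * cis t * h (of_real r * cis t))) has_integral 2 * pi) {0..2*pi}"
proof -
  have "((\<lambda>t. h (of_real r * cis t) * r * \<i> * cis t) has_integral 2 * pi * \<i>) {0..2*pi}"
    using assms has_contour_integral_part_circlepath_iff[of 0 "2*pi" h "2*pi*\<i>" 0 r]
    by (simp add: circlepath_def)
  from has_integral_Im[OF this] show ?thesis
    by (simp add: algebra_simps)
qed

text \<open>The two square terms contribute the logarithmic areas of the image and of the annulus.
  By \<open>wn\<close> the factor Re (z f'/f) of the cross term integrates to 2 pi over every
  circle, so the cross term subtracts the area of the annulus twice, which leaves the
  difference.\<close>

lemma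
  assumes ab: "0 < a" "a < b" and f: "f holomorphic_on open_annulus a b" "inj_on f (open_annulus a b)"
    and nz: "\<And>z. z \<in> open_annulus a b \<Longrightarrow> f z \<noteq> 0"
    and wn: "\<And>r. a < r \<Longrightarrow> r < b \<Longrightarrow>
          ((\<lambda>z. deriv f z / f z) has_contour_integral 2 * pi * \<i>) (circlepath 0 r)"
    and int: "set_integrable lborel (f ` open_annulus a b) (\<lambda>w. 1 / (cmod w)\<^sup>2)"
  shows set_integrable_defect_annulus: "set_integrable lborel (open_annulus a b) (log_deriv_defect f)"
    and set_integral_defect_annulus: "(LINT z:open_annulus a b|lborel. log_deriv_defect f z) =
           log_area (f ` open_annulus a b) - 2 * pi * ln (b / a)"
proof -
  let ?A = "open_annulus a b" and ?h = "\<lambda>z. deriv f z / f z"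
  have zA: "z \<noteq> 0" if "z \<in> ?A" for z using that ab by (auto simp: open_annulus_def)
  have c0: "continuous_on (f ` ?A) (\<lambda>w. 1 / (cmod w)\<^sup>2)"
    using nz by (intro continuous_intros) auto
  have hh: "(cmod (deriv f z))\<^sup>2 * (1 / (cmod (f z))\<^sup>2) = (cmod (?h z))\<^sup>2" for z
    by (simp add: norm_divide power_divide)
  have ch: "continuous_on ?A ?h"
    using nz f(1) by (intro continuous_intros holomorphic_on_imp_continuous_on holomorphic_deriv) auto
  have i1: "set_integrable lborel ?A (\<lambda>z. (cmod (?h z))\<^sup>2)"
    using set_integrable_holomorphic_image[OF open_open_annulus f c0] int unfolding hh by simp
  have v1: "(LINT z:?A|lborel. (cmod (?h z))\<^sup>2) = log_area (f ` ?A)"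
    using set_integral_holomorphic_image[OF open_open_annulus f c0] unfolding hh log_area_def by simp
  have i2: "set_integrable lborel ?A (\<lambda>z. 1 / (cmod z)\<^sup>2)"
    by (rule set_integrable_inverse_square[of _ a])
      (use ab in \<open>auto simp: open_annulus_def intro!: boundedI[of _ b]\<close>)
  have v2: "(LINT z:?A|lborel. 1 / (cmod z)\<^sup>2) = 2 * pi * ln (b / a)"
    using log_area_annulus[OF ab] by (simp add: log_area_def)
  let ?k = "\<lambda>z. Re (z * ?h z)"
  have ck: "continuous_on ?A ?k"
    by (intro continuous_intros ch)
  have ck': "continuous_on ?A (\<lambda>z. ?k z / (cmod z)\<^sup>2)"
    using zA by (intro continuous_intros ck) auto
  \<comment> \<open>With t = |z f'/f|, the bound t <= t^2 + 1, which follows from (t - 1)^2 >= 0, is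
    divided by |z|^2; this dominates the cross term by the two square terms.\<close>
  have i3: "set_integrable lborel ?A (\<lambda>z. ?k z / (cmod z)\<^sup>2)"
  proof (rule set_integrable_bound[OF set_integral_add(1)[OF i1 i2]])
    show "set_borel_measurable lborel ?A (\<lambda>z. ?k z / (cmod z)\<^sup>2)"
      unfolding set_borel_measurable_def
      using borel_measurable_continuous_on_indicator[OF _ ck'] by simp
    have "norm (?k z / (cmod z)\<^sup>2) \<le> norm ((cmod (?h z))\<^sup>2 + 1 / (cmod z)\<^sup>2)" if "z \<in> ?A" for z
    proof -
      have "cmod z > 0" using zA[OF that] by simp
      have "2 * ((cmod z) * (cmod (?h z))) \<le> (cmod z)\<^sup>2 * (cmod (?h z))\<^sup>2 + 1"
        using zero_le_power2[of "cmod z * cmod (?h z) - 1"] by (simp add: power2_eq_square algebra_simps)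
      then have "\<bar>?k z\<bar> \<le> (cmod z)\<^sup>2 * (cmod (?h z))\<^sup>2 + 1"
        using abs_Re_le_cmod[of "z * ?h z"] mult_nonneg_nonneg[of "cmod z" "cmod (?h z)"] by (simp only: norm_mult)
      moreover have "(cmod z)\<^sup>2 * (cmod (?h z))\<^sup>2 + 1 = (cmod z)\<^sup>2 * ((cmod (?h z))\<^sup>2 + 1 / (cmod z)\<^sup>2)"
        using \<open>cmod z > 0\<close> by (simp add: algebra_simps)
      ultimately have "\<bar>?k z\<bar> / (cmod z)\<^sup>2 \<le> (cmod (?h z))\<^sup>2 + 1 / (cmod z)\<^sup>2"
        using \<open>cmod z > 0\<close> by (simp add: pos_divide_le_eq mult.commute)
      then show ?thesis
        by (simp add: abs_of_nonneg)
    qed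
    then show "AE z in lborel. z \<in> ?A \<longrightarrow> norm (?k z / (cmod z)\<^sup>2) \<le> norm ((cmod (?h z))\<^sup>2 + 1 / (cmod z)\<^sup>2)"
      by blast
  qed
  have v3: "(LINT z:?A|lborel. ?k z / (cmod z)\<^sup>2) = 2 * pi * ln (b / a)"
    using has_integral_Re_contour_integral_circlepath[OF wn]
    by (intro set_integral_annulus_circle_mean ab ck i3) auto
  have eq: "log_deriv_defect f z = (cmod (?h z))\<^sup>2 + 1 / (cmod z)\<^sup>2 - 2 * (?k z / (cmod z)\<^sup>2)" if "z \<in> ?A" for z
    using cmod_diff_inverse_square[OF zA[OF that]] unfolding log_deriv_defect_def .
  have i4: "set_integrable lborel ?A (\<lambda>z. 2 * (?k z / (cmod z)\<^sup>2))"
    using i3 by (rule set_integrable_mult_right)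
  show "set_integrable lborel ?A (log_deriv_defect f)"
    using set_integral_diff(1)[OF set_integral_add(1)[OF i1 i2] i4]
    by (subst set_integrable_cong[OF refl refl eq]) auto
  have "(LINT z:?A|lborel. log_deriv_defect f z) = (LINT z:?A|lborel. (cmod (?h z))\<^sup>2 + 1 / (cmod z)\<^sup>2 - 2 * (?k z / (cmod z)\<^sup>2))"
    by (rule set_lebesgue_integral_cong) (use eq in auto)
  also have "\<dots> = log_area (f ` ?A) - 2 * pi * ln (b / a)"
    by (simp only: set_integral_diff(2)[OF set_integral_add(1)[OF i1 i2] i4] set_integral_add(2)[OF i1 i2]
        set_integral_mult_right v1 v2 v3)
  finally show "(LINT z:?A|lborel. log_deriv_defect f z) = log_area (f ` ?A) - 2 * pi * ln (b / a)" .
qed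

section \<open>Discs around 0\<close>

text \<open>Injectivity makes the difference quotient \<open>h\<close> zero-free on all of
  \<open>S\<close>: off \<open>z0\<close> because the values differ, at \<open>z0\<close> because
  the derivative does not vanish. Hence h'/h is holomorphic on \<open>S\<close>, also when
  \<open>S\<close> is not simply connected, and the logarithmic derivative of (z - z0) h isolates
  the pole.\<close>

lemma injective_log_deriv_simple_pole:
  assumes "open S" and f: "f holomorphic_on S" "inj_on f S" and "z0 \<in> S"
  obtains g where "g holomorphic_on S"
    "\<And>z. z \<in> S - {z0} \<Longrightarrow> deriv f z / (f z - f z0) = 1 / (z - z0) + g z"
proof
  define h where "h = (\<lambda>z. if z = z0 then deriv f z0 else (f z - f z0) / (z - z0))"
  have hol: "h holomorphic_on S"
    unfolding h_def using f(1) \<open>open S\<close> by (rule pole_lemma_open)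
  have nz: "h z \<noteq> 0" if "z \<in> S" for z
    using that \<open>z0 \<in> S\<close> f(2) holomorphic_injective_imp_regular[OF f(1) \<open>open S\<close> f(2) \<open>z0 \<in> S\<close>]
    by (auto simp: h_def inj_on_eq_iff)
  show "(\<lambda>z. deriv h z / h z) holomorphic_on S"
    using nz hol \<open>open S\<close> by (intro holomorphic_intros holomorphic_deriv)
  fix z assume z: "z \<in> S - {z0}"
  have fh: "f w = f z0 + (w - z0) * h w" for w
    by (simp add: h_def)
  have "(h has_field_derivative deriv h z) (at z)"
    using z hol \<open>open S\<close> by (intro holomorphic_derivI) auto
  then have "((\<lambda>w. f z0 + (w - z0) * h w) has_field_derivative h z + (z - z0) * deriv h z) (at z)"
    by (auto intro!: derivative_eq_intros)
  then have "deriv f z = h z + (z - z0) * deriv h z"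
    by (simp add: fh[symmetric] DERIV_imp_deriv)
  then show "deriv f z / (f z - f z0) = 1 / (z - z0) + deriv h z / h z"
    using z nz[of z] by (subst fh[of z]) (auto simp: field_simps)
qed

lemma has_contour_integral_log_deriv_disc:
  assumes f: "f holomorphic_on ball 0 \<rho>" "inj_on f (ball 0 \<rho>)" and "f 0 = 0" and r: "0 < r" "r < \<rho>"
  shows "((\<lambda>z. deriv f z / f z) has_contour_integral 2 * pi * \<i>) (circlepath 0 r)"
proof -
  obtain g where g: "g holomorphic_on ball 0 \<rho>"
    "\<And>z. z \<in> ball 0 \<rho> - {0} \<Longrightarrow> deriv f z / (f z - f 0) = 1 / (z - 0) + g z"
    using injective_log_deriv_simple_pole[OF open_ball f, of 0] r by auto
  have "(g has_contour_integral 0) (circlepath 0 r)"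
    using g(1) r by (intro Cauchy_theorem_convex_simple[of _ "ball 0 \<rho>"]) auto
  moreover have "((\<lambda>z. 1 / (z - 0)) has_contour_integral 2 * pi * \<i>) (circlepath 0 r)"
    using Cauchy_integral_circlepath_simple[of "\<lambda>_. 1" 0 r 0] r by simp
  ultimately have "((\<lambda>z. 1 / (z - 0) + g z) has_contour_integral 2 * pi * \<i> + 0) (circlepath 0 r)"
    by (intro has_contour_integral_add)
  then have "((\<lambda>z. 1 / (z - 0) + g z) has_contour_integral 2 * pi * \<i>) (circlepath 0 r)"
    by simp
  then show ?thesis
    by (rule has_contour_integral_eq) (use g(2) r \<open>f 0 = 0\<close> in auto)
qed

lemma log_area_mono:
  assumes "set_integrable lborel T (\<lambda>w. 1 / (cmod w)\<^sup>2)" "S \<in> sets borel" "S \<subseteq> T"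
  shows "log_area S \<le> log_area T"
proof -
  have "set_integrable lborel S (\<lambda>w. 1 / (cmod w)\<^sup>2)"
    using assms by (intro set_integrable_subset[OF assms(1)]) auto
  with assms show ?thesis
    unfolding log_area_def set_lebesgue_integral_def set_integrable_def
    by (intro integral_mono) (auto simp: indicator_def)
qed

lemma log_area_Un:
  assumes "set_integrable lborel S (\<lambda>w. 1 / (cmod w)\<^sup>2)" "set_integrable lborel T (\<lambda>w. 1 / (cmod w)\<^sup>2)" "S \<inter> T = {}"
  shows "log_area (S \<union> T) = log_area S + log_area T"
  unfolding log_area_def using assms by (intro set_integral_Un)

text \<open>The frontier of the open image lies in the image of the sphere of radius
  \<open>\<delta>\<close>, hence outside \<open>cball 0 m\<close>. If this ball is nonempty, it is
  connected and meets the image at f 0 = 0, so it cannot leave it.\<close>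

lemma cball_subset_holomorphic_image_ball:
  assumes f: "f holomorphic_on ball 0 \<rho>" "f 0 = 0" and \<delta>: "0 < \<delta>" "\<delta> < \<rho>"
    and big: "\<And>z. cmod z = \<delta> \<Longrightarrow> m < cmod (f z)" and inj: "inj_on f (ball 0 \<rho>)"
  shows "cball 0 m \<subseteq> f ` ball 0 \<delta>"
proof (cases "m < 0")
  case False
  have op: "open (f ` ball 0 \<delta>)"
    using \<delta> by (intro open_mapping_thm3 holomorphic_on_subset[OF f(1)] inj_on_subset[OF inj]) auto
  have cont: "continuous_on (cball 0 \<delta>) f"
    using \<delta> by (intro holomorphic_on_imp_continuous_on holomorphic_on_subset[OF f(1)]) auto
  then have "closed (f ` cball 0 \<delta>)"
    by (intro compact_imp_closed compact_continuous_image) auto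
  then have "closure (f ` ball 0 \<delta>) \<subseteq> f ` cball 0 \<delta>"
    by (intro closure_minimal) auto
  then have "frontier (f ` ball 0 \<delta>) \<subseteq> f ` sphere 0 \<delta>"
    using op by (force simp: frontier_def interior_open)
  then have "cball 0 m \<inter> frontier (f ` ball 0 \<delta>) = {}"
    using big by force
  moreover have "0 \<in> cball 0 m \<inter> f ` ball 0 \<delta>"
    using f(2) \<delta> False by (auto intro!: image_eqI[of _ _ 0])
  ultimately show ?thesis
    using connected_Int_frontier[of "cball 0 m" "f ` ball 0 \<delta>"]
    by (metis Diff_eq_empty_iff connected_cball empty_iff)
qed auto

lemma holomorphic_near_zero_linear_bounds:
  assumes f: "f holomorphic_on ball 0 \<rho>" and "f 0 = 0" "0 < \<rho>" "deriv f 0 \<noteq> 0" "0 < \<eta>"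
  obtains d where "0 < d" "d < \<rho>"
    "\<And>z. 0 < cmod z \<Longrightarrow> cmod z \<le> d \<Longrightarrow> cmod (deriv f 0) * (1 - \<eta>) * cmod z < cmod (f z)"
    "\<And>z. 0 < cmod z \<Longrightarrow> cmod z \<le> d \<Longrightarrow> cmod (f z) < cmod (deriv f 0) * (1 + \<eta>) * cmod z"
proof -
  let ?a = "cmod (deriv f 0)"
  have "(f has_field_derivative deriv f 0) (at 0)"
    using assms by (intro holomorphic_derivI[OF f]) auto
  then have "(\<lambda>z. f z / z) \<midarrow>0\<rightarrow> deriv f 0"
    using \<open>f 0 = 0\<close> by (simp add: has_field_derivative_iff)
  then have "(\<lambda>z. cmod (f z / z)) \<midarrow>0\<rightarrow> ?a"
    by (rule tendsto_norm)
  moreover have "0 < ?a * \<eta>" using assms by simp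
  ultimately have "eventually (\<lambda>z. dist (cmod (f z / z)) ?a < ?a * \<eta>) (at 0)"
    by (rule tendstoD)
  then obtain e where e: "0 < e" "\<And>z. z \<noteq> 0 \<Longrightarrow> cmod z < e \<Longrightarrow> \<bar>cmod (f z / z) - ?a\<bar> < ?a * \<eta>"
    unfolding eventually_at by (auto simp: dist_real_def)
  define d where "d = min e \<rho> / 2"
  have d: "0 < d" "d < e" "d < \<rho>" using e(1) \<open>0 < \<rho>\<close> by (auto simp: d_def)
  have *: "?a * (1 - \<eta>) < cmod (f z) / cmod z \<and> cmod (f z) / cmod z < ?a * (1 + \<eta>)"
    if "0 < cmod z" "cmod z \<le> d" for z
    using e(2)[of z] that d by (auto simp: norm_divide abs_less_iff algebra_simps)
  show ?thesis
  proof (rule that[OF d(1,3)])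
    fix z :: complex assume z: "0 < cmod z" "cmod z \<le> d"
    show "?a * (1 - \<eta>) * cmod z < cmod (f z)"
      using *[OF z] z(1) by (simp add: pos_less_divide_eq)
    show "cmod (f z) < ?a * (1 + \<eta>) * cmod z"
      using *[OF z] z(1) by (simp add: pos_divide_less_eq)
  qed
qed

text \<open>The image has infinite logarithmic area near 0, so \<open>ball 0 s\<close> is cut out as
  a reference. Once the disc of radius \<open>\<delta>\<close> is removed, the image has area about
  2 pi ln (s / (|f'(0)| \<delta>)) inside the reference ball, while the annulus subtracts 2 pi ln
  (\<rho> / \<delta>). The terms that diverge with \<open>\<delta>\<close> cancel and leave the
  stated constant.\<close>

lemma
  assumes "0 < \<rho>" and f: "f holomorphic_on ball 0 \<rho>" and inj: "inj_on f (ball 0 \<rho>)" and f0: "f 0 = 0"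
    and s: "0 < s" "ball 0 s \<subseteq> f ` ball 0 \<rho>"
    and int: "set_integrable lborel (f ` ball 0 \<rho> - ball 0 s) (\<lambda>w. 1 / (cmod w)\<^sup>2)"
  shows set_integrable_defect_disc: "set_integrable lborel (ball 0 \<rho>) (log_deriv_defect f)"
    and set_integral_defect_disc: "(LINT z:ball 0 \<rho>|lborel. log_deriv_defect f z) =
           log_area (f ` ball 0 \<rho> - ball 0 s) + 2 * pi * ln (s / (\<rho> * cmod (deriv f 0)))"
proof -
  let ?I = "\<lambda>w. 1 / (cmod w)\<^sup>2" and ?a = "cmod (deriv f 0)" and ?G = "f ` ball 0 \<rho>"
  let ?C = "log_area (?G - ball 0 s) + 2 * pi * ln (s / (\<rho> * ?a))"
  define J where "J = (\<lambda>\<delta>. LINT z:open_annulus \<delta> \<rho>|lborel. log_deriv_defect f z)"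
  have d0: "deriv f 0 \<noteq> 0"
    using holomorphic_injective_imp_regular[OF f open_ball inj] \<open>0 < \<rho>\<close> by simp
  then have a: "0 < ?a" by simp
  have opG: "open ?G" by (intro open_mapping_thm3 f inj) auto
  have nz: "f z \<noteq> 0" if "z \<in> ball 0 \<rho>" "z \<noteq> 0" for z
    using that inj f0 \<open>0 < \<rho>\<close> by (metis centre_in_ball inj_onD)
  have ann: "open_annulus \<delta> \<rho> = ball 0 \<rho> - cball 0 \<delta>" for \<delta>
    by (auto simp: open_annulus_def)
  have fann: "f ` open_annulus \<delta> \<rho> = (?G - ball 0 s) \<union> (ball 0 s - f ` cball 0 \<delta>)"
    if "0 < \<delta>" "\<delta> < \<rho>" "f ` cball 0 \<delta> \<subseteq> ball 0 s" for \<delta>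
  proof -
    have "f ` open_annulus \<delta> \<rho> = ?G - f ` cball 0 \<delta>"
      unfolding ann using that by (intro inj_on_image_set_diff[OF inj]) auto
    also have "\<dots> = (?G - ball 0 s) \<union> (ball 0 s - f ` cball 0 \<delta>)"
      using that s by blast
    finally show ?thesis .
  qed
  have sub: "open_annulus \<delta> \<rho> \<subseteq> ball 0 \<rho>" for \<delta> unfolding ann by blast
  have closed_im: "closed (f ` cball 0 \<delta>)" if "\<delta> < \<rho>" for \<delta>
    using that
    by (intro compact_imp_closed compact_continuous_image holomorphic_on_imp_continuous_on
        holomorphic_on_subset[OF f]) auto
  \<comment> \<open>Inside \<open>ball 0 s\<close> the density is bounded on the image, which omits
    a small ball around 0 contained in the image of \<open>ball 0 \<delta>\<close>; outside
    \<open>ball 0 s\<close> the hypothesis \<open>int\<close> applies.\<close>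
  have intA: "set_integrable lborel (f ` open_annulus \<delta> \<rho>) ?I" if \<delta>: "0 < \<delta>" "\<delta> < \<rho>" for \<delta>
  proof -
    have "open (f ` ball 0 \<delta>)"
      using \<delta> by (intro open_mapping_thm3 holomorphic_on_subset[OF f] inj_on_subset[OF inj]) auto
    moreover have "0 \<in> f ` ball 0 \<delta>" using f0 \<delta> by (auto intro!: image_eqI[of _ _ 0])
    ultimately obtain e where e: "0 < e" "ball 0 e \<subseteq> f ` ball 0 \<delta>"
      using open_contains_ball by blast
    have m: "open (f ` open_annulus \<delta> \<rho>)"
      by (intro open_mapping_thm3 holomorphic_on_subset[OF f sub] inj_on_subset[OF inj sub]) auto
    have "f ` open_annulus \<delta> \<rho> \<inter> f ` ball 0 \<delta> = {}"
      unfolding ann using \<delta> by (subst inj_on_image_Int[OF inj, symmetric]) auto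
    then have "e \<le> cmod w" if "w \<in> f ` open_annulus \<delta> \<rho>" for w
      using that e(2) by (meson disjoint_iff mem_ball_0 not_less subsetD)
    then have "set_integrable lborel (f ` open_annulus \<delta> \<rho> \<inter> ball 0 s) ?I"
      using e(1) m by (intro set_integrable_inverse_square[of _ e]) auto
    moreover have "set_integrable lborel (f ` open_annulus \<delta> \<rho> - ball 0 s) ?I"
      by (rule set_integrable_subset[OF int]) (use m sub in auto)
    ultimately have "set_integrable lborel ((f ` open_annulus \<delta> \<rho> \<inter> ball 0 s) \<union> (f ` open_annulus \<delta> \<rho> - ball 0 s)) ?I"
      using m by (intro set_integrable_Un) auto
    then show ?thesis by (simp add: Int_Diff_Un)
  qed
  have ad: "set_integrable lborel (open_annulus \<delta> \<rho>) (log_deriv_defect f)"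
       "J \<delta> = log_area (f ` open_annulus \<delta> \<rho>) - 2 * pi * ln (\<rho> / \<delta>)" if \<delta>: "0 < \<delta>" "\<delta> < \<rho>" for \<delta>
  proof -
    have z: "f z \<noteq> 0" if "z \<in> open_annulus \<delta> \<rho>" for z
      using that \<delta> nz[of z] by (force simp: open_annulus_def)
    show "set_integrable lborel (open_annulus \<delta> \<rho>) (log_deriv_defect f)"
      by (rule set_integrable_defect_annulus[OF \<delta> holomorphic_on_subset[OF f sub] inj_on_subset[OF inj sub] z _ intA[OF \<delta>]])
        (use has_contour_integral_log_deriv_disc[OF f inj f0] \<delta> in auto)
    show "J \<delta> = log_area (f ` open_annulus \<delta> \<rho>) - 2 * pi * ln (\<rho> / \<delta>)"
      unfolding J_def
      by (rule set_integral_defect_annulus[OF \<delta> holomorphic_on_subset[OF f sub] inj_on_subset[OF inj sub] z _ intA[OF \<delta>]])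
        (use has_contour_integral_log_deriv_disc[OF f inj f0] \<delta> in auto)
  qed
  have bounds: "\<exists>d>0. \<forall>\<delta>. 0 < \<delta> \<and> \<delta> < d \<longrightarrow> ?C - 2 * pi * ln (1 + \<eta>) \<le> J \<delta> \<and> J \<delta> \<le> ?C - 2 * pi * ln (1 - \<eta>)"
    if \<eta>: "0 < \<eta>" "\<eta> < 1" for \<eta>
  proof -
    obtain d where d: "0 < d" "d < \<rho>"
      "\<And>z. 0 < cmod z \<Longrightarrow> cmod z \<le> d \<Longrightarrow> ?a * (1 - \<eta>) * cmod z < cmod (f z)"
      "\<And>z. 0 < cmod z \<Longrightarrow> cmod z \<le> d \<Longrightarrow> cmod (f z) < ?a * (1 + \<eta>) * cmod z"
      using holomorphic_near_zero_linear_bounds[OF f f0 \<open>0 < \<rho>\<close> d0 \<eta>(1)] by metis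
    \<comment> \<open>The second bound keeps the image of \<open>cball 0 \<delta>\<close>, which
      lies in a disc of radius |f'(0)| (1 + \<eta>) \<delta>, inside
      \<open>ball 0 s\<close>.\<close>
    define d' where "d' = min d (s / (?a * (1 + \<eta>)))"
    have d': "0 < d'" using d a \<eta> s by (auto simp: d'_def)
    have "?C - 2 * pi * ln (1 + \<eta>) \<le> J \<delta> \<and> J \<delta> \<le> ?C - 2 * pi * ln (1 - \<eta>)" if \<delta>: "0 < \<delta>" "\<delta> < d'" for \<delta>
    proof -
      define M where "M = ?a * (1 + \<eta>) * \<delta>"
      define m where "m = ?a * (1 - \<eta>) * \<delta>"
      have pos: "0 < m" "0 < M" using a \<eta> \<delta> by (auto simp: m_def M_def)
      have "\<delta> < s / (?a * (1 + \<eta>))" using \<delta> by (simp add: d'_def)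
      then have Ms: "M < s" unfolding M_def using a \<eta>
        by (simp add: pos_less_divide_eq mult.commute mult.left_commute)
      have ms: "m < s" using Ms a \<eta> \<delta> unfolding m_def M_def
        by (smt (verit) mult_less_cancel_left_pos mult_less_cancel_right_pos)
      have \<delta>\<rho>: "\<delta> < \<rho>" and \<delta>d: "\<delta> \<le> d" using \<delta> d by (auto simp: d'_def)
      have up: "f ` cball 0 \<delta> \<subseteq> cball 0 M"
      proof
        fix w assume "w \<in> f ` cball 0 \<delta>"
        then obtain z where z: "w = f z" "cmod z \<le> \<delta>" by auto
        show "w \<in> cball 0 M"
        proof (cases "z = 0")
          case False
          then have "cmod (f z) < ?a * (1 + \<eta>) * cmod z" using d(4)[of z] z \<delta>d by auto
          also have "\<dots> \<le> M" unfolding M_def using z a \<eta> by (intro mult_left_mono) auto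
          finally show ?thesis using z by simp
        qed (use z f0 pos in auto)
      qed
      have low: "cball 0 m \<subseteq> f ` ball 0 \<delta>"
      proof (rule cball_subset_holomorphic_image_ball[OF f f0 \<delta>(1) \<delta>\<rho> _ inj])
        fix z assume "cmod z = \<delta>"
        then show "m < cmod (f z)" using d(3)[of z] \<delta> \<delta>d by (simp add: m_def)
      qed
      \<comment> \<open>The image of the small disc is squeezed between round discs of radii
        \<open>m\<close> and \<open>M\<close>, so this region is squeezed between the annuli with
        these inner radii and outer radius \<open>s\<close>.\<close>
      let ?R = "ball 0 s - f ` cball 0 \<delta>"
      have R: "?R \<in> sets borel" using closed_im[OF \<delta>\<rho>] by auto
      have s1: "open_annulus M s \<subseteq> ?R" using up by (auto simp: open_annulus_def subset_iff)
      have "cball 0 m \<subseteq> f ` cball 0 \<delta>" using low by (meson ball_subset_cball image_mono order_trans)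
      then have s2: "?R \<subseteq> open_annulus m s" by (auto simp: open_annulus_def subset_iff not_le)
      have im: "set_integrable lborel (open_annulus m s) ?I"
        by (rule set_integrable_inverse_square[of _ m])
          (use pos in \<open>auto simp: open_annulus_def intro!: boundedI[of _ s]\<close>)
      have iR: "set_integrable lborel ?R ?I" using R s2 by (intro set_integrable_subset[OF im]) auto
      have l1: "2 * pi * ln (s / M) \<le> log_area ?R"
        using log_area_mono[OF iR _ s1] log_area_annulus[OF pos(2) Ms] by simp
      have l2: "log_area ?R \<le> 2 * pi * ln (s / m)"
        using log_area_mono[OF im R s2] log_area_annulus[OF pos(1) ms] by simp
      have upb: "f ` cball 0 \<delta> \<subseteq> ball 0 s" using up Ms by (auto simp: subset_iff)
      have "log_area (f ` open_annulus \<delta> \<rho>) = log_area (?G - ball 0 s) + log_area ?R"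
        unfolding fann[OF \<delta>(1) \<delta>\<rho> upb] by (rule log_area_Un[OF int iR]) auto
      then have J: "J \<delta> = log_area (?G - ball 0 s) + log_area ?R - 2 * pi * ln (\<rho> / \<delta>)"
        using ad(2)[OF \<delta>(1) \<delta>\<rho>] by simp
      have "ln (s / M) - ln (\<rho> / \<delta>) = ln (s / (\<rho> * ?a)) - ln (1 + \<eta>)"
        using a \<eta> \<delta> s \<open>0 < \<rho>\<close> by (simp add: M_def ln_div ln_mult)
      then have e1: "2 * pi * ln (s / M) - 2 * pi * ln (\<rho> / \<delta>) = 2 * pi * ln (s / (\<rho> * ?a)) - 2 * pi * ln (1 + \<eta>)"
        by (simp only: flip: right_diff_distrib)
      have "ln (s / m) - ln (\<rho> / \<delta>) = ln (s / (\<rho> * ?a)) - ln (1 - \<eta>)"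
        using a \<eta> \<delta> s \<open>0 < \<rho>\<close> by (simp add: m_def ln_div ln_mult)
      then have e2: "2 * pi * ln (s / m) - 2 * pi * ln (\<rho> / \<delta>) = 2 * pi * ln (s / (\<rho> * ?a)) - 2 * pi * ln (1 - \<eta>)"
        by (simp only: flip: right_diff_distrib)
      show ?thesis using J l1 l2 e1 e2 by linarith
    qed
    with d' show ?thesis by blast
  qed
  \<comment> \<open>The shift by 2 rather than 1 keeps \<open>\<delta> 0\<close> strictly below
    \<open>\<rho>\<close>.\<close>
  define \<delta> where "\<delta> = (\<lambda>n::nat. \<rho> / (real n + 2))"
  have \<delta>: "0 < \<delta> n" "\<delta> n < \<rho>" for n using \<open>0 < \<rho>\<close> by (auto simp: \<delta>_def divide_less_eq_1_pos pos_divide_less_eq add_pos_nonneg)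
  have \<delta>lim: "\<delta> \<longlonglongrightarrow> 0" unfolding \<delta>_def by real_asymp
  have Jlim: "(\<lambda>n. J (\<delta> n)) \<longlonglongrightarrow> ?C"
  proof (rule LIMSEQ_I)
    fix e :: real assume "0 < e"
    \<comment> \<open>Chosen so that 2 pi ln (1 - \<eta>) is exactly -e / 2. Then \<eta> <= e / (4
      pi), and ln (1 + \<eta>) <= \<eta> bounds the other side by e / 2 as well.\<close>
    define \<eta> where "\<eta> = 1 - exp (- (e / (4 * pi)))"
    have \<eta>: "0 < \<eta>" "\<eta> < 1" using \<open>0 < e\<close> by (auto simp: \<eta>_def)
    have "\<eta> \<le> e / (4 * pi)" using exp_ge_add_one_self[of "- (e / (4 * pi))"] unfolding \<eta>_def by linarith
    then have "ln (1 + \<eta>) \<le> e / (4 * pi)" using ln_add_one_self_le_self[of \<eta>] \<eta> by linarith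
    then have b1: "2 * pi * ln (1 + \<eta>) \<le> e / 2" by (simp add: field_simps)
    have "ln (1 - \<eta>) = - (e / (4 * pi))" by (simp add: \<eta>_def)
    then have b2: "2 * pi * ln (1 - \<eta>) = - (e / 2)" by (simp add: field_simps)
    obtain d where d: "d > 0" "\<And>\<delta>. 0 < \<delta> \<Longrightarrow> \<delta> < d \<Longrightarrow> ?C - 2 * pi * ln (1 + \<eta>) \<le> J \<delta> \<and> J \<delta> \<le> ?C - 2 * pi * ln (1 - \<eta>)"
      using bounds[OF \<eta>] by blast
    obtain N where N: "\<And>n. n \<ge> N \<Longrightarrow> \<bar>\<delta> n\<bar> < d"
      using LIMSEQ_D[OF \<delta>lim d(1)] by auto
    have "norm (J (\<delta> n) - ?C) < e" if "n \<ge> N" for n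
    proof -
      have "\<delta> n < d" using N[OF that] by linarith
      from d(2)[OF \<delta>(1) this] show ?thesis
        using b1 b2 \<open>0 < e\<close> unfolding real_norm_def abs_less_iff by linarith
    qed
    then show "\<exists>N. \<forall>n\<ge>N. norm (J (\<delta> n) - ?C) < e" by blast
  qed
  define u where "u = (\<lambda>z. indicator (ball 0 \<rho>) z *\<^sub>R log_deriv_defect f z)"
  define g where "g = (\<lambda>n z. indicator (open_annulus (\<delta> n) \<rho>) z *\<^sub>R log_deriv_defect f z)"
  have gi: "integrable lborel (g n)" for n
    using ad(1)[OF \<delta>] by (simp add: g_def set_integrable_def)
  have mono: "mono (\<lambda>n. g n z)" for z
  proof (rule monoI)
    fix m n :: nat assume "m \<le> n"
    then have "\<delta> n \<le> \<delta> m" using \<open>0 < \<rho>\<close> by (auto simp: \<delta>_def intro!: divide_left_mono)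
    then show "g m z \<le> g n z" by (auto simp: g_def indicator_def open_annulus_def log_deriv_defect_def)
  qed
  have lim: "(\<lambda>n. g n z) \<longlonglongrightarrow> u z" for z
  proof (cases "z = 0")
    case True
    \<comment> \<open>By the convention \<open>x / 0 = 0\<close>, the defect vanishes at 0.\<close>
    then show ?thesis using f0 by (simp add: g_def u_def log_deriv_defect_def)
  next
    case False
    then have "eventually (\<lambda>n. \<delta> n < cmod z) sequentially"
      using order_tendstoD(2)[OF \<delta>lim, of "cmod z"] by simp
    then have "eventually (\<lambda>n. u z = g n z) sequentially"
      by eventually_elim (auto simp: u_def g_def open_annulus_def indicator_def)
    then show ?thesis by (rule tendsto_eventually[OF eventually_mono]) auto
  qed
  have um: "u \<in> borel_measurable lborel"
    by (rule borel_measurable_LIMSEQ_real[OF lim]) (use gi in auto)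
  have Jl: "(\<lambda>n. integral\<^sup>L lborel (g n)) \<longlonglongrightarrow> ?C"
    using Jlim by (simp add: J_def g_def set_lebesgue_integral_def)
  \<comment> \<open>The defect is nonnegative, so the truncations increase, and monotone convergence
    to a finite limit yields integrability together with the value.\<close>
  have "has_bochner_integral lborel u ?C"
    by (rule has_bochner_integral_monotone_convergence[of lborel g]) (use gi mono lim Jl um in auto)
  then show "set_integrable lborel (ball 0 \<rho>) (log_deriv_defect f)"
    and "(LINT z:ball 0 \<rho>|lborel. log_deriv_defect f z) = ?C"
    unfolding has_bochner_integral_iff set_integrable_def set_lebesgue_integral_def u_def by auto
qed

section \<open>Winding numbers on the Riemann sphere\<close>

lemma path_image_circlepath_open_annulus:
  assumes "0 < a" "a < r" "r < b"
  shows "path_image (circlepath 0 r) \<subseteq> open_annulus a b"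
  using assms by (auto simp: open_annulus_def)

lemma contour_integral_circlepath_annulus_eq:
  assumes h: "h holomorphic_on open_annulus a b" and "0 < a" "a < r" "r \<le> r'" "r' < b"
  shows "contour_integral (circlepath 0 r) h = contour_integral (circlepath 0 r') h"
proof (rule Cauchy_theorem_homotopic_loops[OF _ open_open_annulus h])
  show "homotopic_loops (open_annulus a b) (circlepath 0 r) (circlepath 0 r')"
  proof (rule homotopic_loops_linear)
    fix t :: real
    show "closed_segment (circlepath 0 r t) (circlepath 0 r' t) \<subseteq> open_annulus a b"
    proof
      fix z assume "z \<in> closed_segment (circlepath 0 r t) (circlepath 0 r' t)"
      then obtain u where u: "0 \<le> u" "u \<le> 1" "z = (1 - u) *\<^sub>R circlepath 0 r t + u *\<^sub>R circlepath 0 r' t"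
        unfolding in_segment by blast
      have "z = of_real ((1 - u) * r + u * r') * exp (2 * of_real pi * \<i> * of_real t)"
        unfolding u(3) circlepath by (simp add: scaleR_conv_of_real algebra_simps)
      then have "cmod z = \<bar>(1 - u) * r + u * r'\<bar>"
        by (simp only: norm_mult norm_of_real) (simp add: norm_exp_eq_Re)
      moreover have "r \<le> (1 - u) * r + u * r'"
        using u assms mult_left_mono[of r r' u] by (simp add: algebra_simps)
      moreover have "(1 - u) * r + u * r' \<le> r'"
        using u assms mult_left_mono[of r r' "1 - u"] by (simp add: algebra_simps)
      ultimately show "z \<in> open_annulus a b"
        using assms by (simp add: open_annulus_def)
    qed
  qed (auto simp: path_circlepath)
qed auto

text \<open>Links integrals of f'/(f - w), where poles can be split off, to winding numbers of the
  image curve, which are locally constant in w.\<close>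

lemma winding_number_comp_circlepath:
  assumes ab: "0 < a" "a < r" "r < b" and f: "f holomorphic_on open_annulus a b"
    and w: "w \<notin> f ` sphere 0 r"
  shows "contour_integral (circlepath 0 r) (\<lambda>z. deriv f z / (f z - w))
      = 2 * pi * \<i> * winding_number (f \<circ> circlepath 0 r) w"
proof -
  have an: "f analytic_on open_annulus a b"
    using f by (simp add: analytic_on_open)
  note pi = path_image_circlepath_open_annulus[OF ab]
  have vp: "valid_path (f \<circ> circlepath 0 r)"
    by (rule valid_path_compose_analytic[OF _ an pi]) simp
  have "winding_number (f \<circ> circlepath 0 r) w
      = 1 / (2 * pi * \<i>) * contour_integral (f \<circ> circlepath 0 r) (\<lambda>v. 1 / (v - w))"
    using w ab by (intro winding_number_valid_path vp) (auto simp: path_image_compose)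
  also have "contour_integral (f \<circ> circlepath 0 r) (\<lambda>v. 1 / (v - w))
      = contour_integral (circlepath 0 r) (\<lambda>z. deriv f z * (1 / (f z - w)))"
    by (rule contour_integral_comp_analyticW[OF an _ pi]) simp
  finally have "winding_number (f \<circ> circlepath 0 r) w
      = 1 / (2 * pi * \<i>) * contour_integral (circlepath 0 r) (\<lambda>z. deriv f z / (f z - w))"
    by (simp only: times_divide_eq_right mult_1_right)
  moreover have "y = 2 * pi * \<i> * x" if "x = 1 / (2 * pi * \<i>) * y" for x y
    using that by simp
  ultimately show ?thesis by blast
qed

lemma has_contour_integral_circlepath_inverse:
  assumes "0 < r" "cmod z0 \<noteq> r"
  shows "((\<lambda>z. 1 / (z - z0)) has_contour_integral (if cmod z0 < r then 2 * pi * \<i> else 0)) (circlepath 0 r)"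
proof (cases "cmod z0 < r")
  case True
  then show ?thesis using Cauchy_integral_circlepath_simple[of "\<lambda>_. 1" 0 r z0] by simp
next
  case False
  then have "((\<lambda>z. 1 / (z - z0)) has_contour_integral 0) (circlepath 0 r)"
    using assms by (intro Cauchy_theorem_convex_simple[of _ "cball 0 r"] holomorphic_intros) auto
  then show ?thesis using False by simp
qed

text \<open>For fixed \<zeta>, the integral of f'/(f - f(\<zeta>)) over the circle of radius u is a
  constant I(\<zeta>), plus 2 pi i if \<zeta> lies inside the circle: the pole contributes the jump,
  and the holomorphic remainder has the same integral over all circles. A circle of radius
  \<open>t\<close> with both points outside shows that I agrees at \<open>z1\<close> and
  \<open>z2\<close>; the circle of radius \<open>r\<close> has only \<open>z1\<close>
  inside.\<close>

lemma winding_number_annulus_image_jump: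
  assumes ab: "0 < a" and f: "f holomorphic_on open_annulus a b" "inj_on f (open_annulus a b)"
    and z: "a < cmod z1" "cmod z1 < r" "r < cmod z2" "cmod z2 < b"
  shows "winding_number (f \<circ> circlepath 0 r) (f z1) = winding_number (f \<circ> circlepath 0 r) (f z2) + 1"
proof -
  let ?S = "open_annulus a b" and ?c = "\<lambda>r z. contour_integral (circlepath 0 r) (\<lambda>w. deriv f w / (f w - f z))"
  obtain t where t: "a < t" "t < cmod z1" using z(1) dense by blast
  have zS: "z1 \<in> ?S" "z2 \<in> ?S" using z by (auto simp: open_annulus_def)
  have notin: "f z \<notin> f ` sphere 0 u" if "z \<in> ?S" "cmod z \<noteq> u" "a < u" "u < b" for z u
    using that f(2) by (auto simp: inj_on_eq_iff open_annulus_def)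
  have split: "\<exists>I. \<forall>u. a < u \<and> u < b \<and> u \<noteq> cmod z \<longrightarrow> ?c u z = (if cmod z < u then 2 * pi * \<i> else 0) + I"
    if zS: "z \<in> ?S" for z
  proof -
    obtain g where g: "g holomorphic_on ?S"
      "\<And>w. w \<in> ?S - {z} \<Longrightarrow> deriv f w / (f w - f z) = 1 / (w - z) + g w"
      using injective_log_deriv_simple_pole[OF open_open_annulus f zS] by blast
    have const: "contour_integral (circlepath 0 u) g = contour_integral (circlepath 0 r) g" if "a < u" "u < b" for u
    proof (cases "u \<le> r")
      case True
      then show ?thesis using that z
        by (intro contour_integral_circlepath_annulus_eq[OF g(1) ab]) auto
    next
      case False
      then show ?thesis using that z
        by (intro contour_integral_circlepath_annulus_eq[OF g(1) ab, symmetric]) auto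
    qed
    have "?c u z = (if cmod z < u then 2 * pi * \<i> else 0) + contour_integral (circlepath 0 r) g"
      if u: "a < u" "u < b" "u \<noteq> cmod z" for u
    proof -
      have "(g has_contour_integral contour_integral (circlepath 0 u) g) (circlepath 0 u)"
        by (intro has_contour_integral_integral contour_integrable_holomorphic_simple[OF g(1) open_open_annulus]
            path_image_circlepath_open_annulus) (use u ab in auto)
      with has_contour_integral_circlepath_inverse[of u z] u ab
      have "((\<lambda>w. 1 / (w - z) + g w) has_contour_integral
          (if cmod z < u then 2 * pi * \<i> else 0) + contour_integral (circlepath 0 u) g) (circlepath 0 u)"
        by (intro has_contour_integral_add) auto
      then have "((\<lambda>w. deriv f w / (f w - f z)) has_contour_integral
          (if cmod z < u then 2 * pi * \<i> else 0) + contour_integral (circlepath 0 u) g) (circlepath 0 u)"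
      proof (rule has_contour_integral_eq)
        fix w assume "w \<in> path_image (circlepath 0 u)"
        then have "w \<in> ?S - {z}" using u ab by (auto simp: open_annulus_def)
        from g(2)[OF this] show "1 / (w - z) + g w = deriv f w / (f w - f z)" by simp
      qed
      then show ?thesis
        using const[OF u(1,2)] by (simp add: contour_integral_unique)
    qed
    then show ?thesis by blast
  qed
  obtain I1 where I1: "\<And>u. a < u \<Longrightarrow> u < b \<Longrightarrow> u \<noteq> cmod z1 \<Longrightarrow> ?c u z1 = (if cmod z1 < u then 2 * pi * \<i> else 0) + I1"
    using split[OF zS(1)] by blast
  obtain I2 where I2: "\<And>u. a < u \<Longrightarrow> u < b \<Longrightarrow> u \<noteq> cmod z2 \<Longrightarrow> ?c u z2 = (if cmod z2 < u then 2 * pi * \<i> else 0) + I2"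
    using split[OF zS(2)] by blast
  have cw: "?c u z = 2 * pi * \<i> * winding_number (f \<circ> circlepath 0 u) (f z)"
    if "z \<in> ?S" "cmod z \<noteq> u" "a < u" "u < b" for z u
    using that by (intro winding_number_comp_circlepath[OF ab _ _ f(1)] notin)
  \<comment> \<open>The part of the annulus outside the circle of radius \<open>t\<close> is
    connected and contains both points; by injectivity its image misses the image of the
    circle.\<close>
  have "winding_number (f \<circ> circlepath 0 t) (f z1) = winding_number (f \<circ> circlepath 0 t) (f z2)"
  proof (rule winding_number_eq)
    have sub: "path_image (circlepath 0 t) \<subseteq> ?S"
      using t z ab by (intro path_image_circlepath_open_annulus) auto
    show "path (f \<circ> circlepath 0 t)"
      by (intro path_continuous_image holomorphic_on_imp_continuous_on holomorphic_on_subset[OF f(1) sub])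
        (simp add: path_circlepath)
    show "f z1 \<in> f ` open_annulus t b" "f z2 \<in> f ` open_annulus t b"
      using t z by (auto simp: open_annulus_def)
    have sub': "open_annulus t b \<subseteq> ?S" using t by (auto simp: open_annulus_def)
    have "connected (open_annulus t b)"
      using connected_annulus(1)[of t "0::complex" b] by (simp add: open_annulus_def)
    then show "connected (f ` open_annulus t b)"
      by (intro connected_continuous_image holomorphic_on_imp_continuous_on holomorphic_on_subset[OF f(1) sub'])
    show "f ` open_annulus t b \<inter> path_image (f \<circ> circlepath 0 t) = {}"
      using inj_on_image_Int[OF f(2) sub' sub] t ab
      by (auto simp: path_image_compose open_annulus_def)
  qed (simp add: pathfinish_compose pathstart_compose)
  then have "?c t z1 = ?c t z2"
    using cw[of z1 t] cw[of z2 t] zS t z by simp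
  then have "I1 = I2"
    using I1[of t] I2[of t] t z by simp
  then have "?c r z1 = ?c r z2 + 2 * pi * \<i>"
    using I1[of r] I2[of r] z by simp
  then have "2 * pi * \<i> * winding_number (f \<circ> circlepath 0 r) (f z1)
      = 2 * pi * \<i> * (winding_number (f \<circ> circlepath 0 r) (f z2) + 1)"
    using cw[of z1 r] cw[of z2 r] zS z by (simp add: algebra_simps)
  then show ?thesis by simp
qed

text \<open>The value 0 at infinity keeps the winding number of a closed path locally constant on
  the sphere, since it vanishes far from the curve. Complementary components can thus be followed
  through infinity.\<close>

definition sphere_winding_number :: "(real \<Rightarrow> complex) \<Rightarrow> complex option \<Rightarrow> complex" where
  "sphere_winding_number \<gamma> x = (case x of None \<Rightarrow> 0 | Some w \<Rightarrow> winding_number \<gamma> w)"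

lemma topspace_riemann_sphere [simp]: "topspace riemann_sphere = UNIV"
  by (simp add: riemann_sphere_def UNIV_option_conv)

lemma openin_sphere_winding_number_level:
  assumes "path \<gamma>" "pathfinish \<gamma> = pathstart \<gamma>"
  shows "openin riemann_sphere {x. x \<notin> Some ` path_image \<gamma> \<and> sphere_winding_number \<gamma> x = k}"
proof -
  let ?L = "{w. w \<notin> path_image \<gamma> \<and> winding_number \<gamma> w = k}"
  have L: "open ?L" using assms by (rule open_winding_number_levelsets)
  show ?thesis
  proof (cases "k = 0")
    \<comment> \<open>Only the level 0 contains infinity; openness there requires the rest of the
      plane to be compact.\<close>
    case True
    obtain B where B: "\<And>z. B \<le> cmod z \<Longrightarrow> winding_number \<gamma> z = 0"
      using winding_number_zero_at_infinity[OF assms] by blast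
    have "bounded (path_image \<gamma> \<union> cball 0 B)"
      using assms(1) by (simp add: bounded_path_image)
    then have "bounded (- ?L)"
      by (rule bounded_subset) (use B True in force)
    then have "compact (- ?L)" using L by (metis closed_Compl compact_eq_bounded_closed)
    moreover have "{x. x \<notin> Some ` path_image \<gamma> \<and> sphere_winding_number \<gamma> x = k} = insert None (Some ` (UNIV - (- ?L)))"
    proof (rule set_eqI)
      fix x
      show "x \<in> {x. x \<notin> Some ` path_image \<gamma> \<and> sphere_winding_number \<gamma> x = k}
          \<longleftrightarrow> x \<in> insert None (Some ` (UNIV - (- ?L)))"
        using True by (cases x) (auto simp: sphere_winding_number_def)
    qed
    ultimately show ?thesis
      unfolding riemann_sphere_def openin_Alexandroff_compactification
      by (intro disjI2 exI[of _ "- ?L"]) (use L in auto)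
  next
    case False
    have "x \<in> {x. x \<notin> Some ` path_image \<gamma> \<and> sphere_winding_number \<gamma> x = k} \<longleftrightarrow> x \<in> Some ` ?L" for x
      using False by (cases x) (auto simp: sphere_winding_number_def)
    then have "{x. x \<notin> Some ` path_image \<gamma> \<and> sphere_winding_number \<gamma> x = k} = Some ` ?L"
      by blast
    then show ?thesis using L by (simp add: riemann_sphere_def)
  qed
qed

lemma sphere_winding_number_constant:
  assumes \<gamma>: "path \<gamma>" "pathfinish \<gamma> = pathstart \<gamma>"
    and K: "connectedin riemann_sphere K" "K \<inter> Some ` path_image \<gamma> = {}" and xy: "x \<in> K" "y \<in> K"
  shows "sphere_winding_number \<gamma> x = sphere_winding_number \<gamma> y"
proof (rule ccontr)
  assume ne: "sphere_winding_number \<gamma> x \<noteq> sphere_winding_number \<gamma> y"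
  define E where "E k = {x. x \<notin> Some ` path_image \<gamma> \<and> sphere_winding_number \<gamma> x = k}" for k
  define U where "U = E (sphere_winding_number \<gamma> x)"
  define V where "V = (\<Union>k\<in>-{sphere_winding_number \<gamma> x}. E k)"
  have "openin riemann_sphere U" "openin riemann_sphere V"
    using openin_sphere_winding_number_level[OF \<gamma>, folded E_def] by (auto simp: U_def V_def)
  moreover have E: "y \<in> E k \<longleftrightarrow> sphere_winding_number \<gamma> y = k" if "y \<in> K" for y k
    using that K(2) unfolding E_def disjoint_iff mem_Collect_eq by simp
  have "K \<subseteq> U \<union> V"
    using E by (auto simp: U_def V_def)
  moreover have "U \<inter> V \<inter> K = {}"
    using E by (auto simp: U_def V_def)
  moreover have "x \<in> U \<inter> K" "y \<in> V \<inter> K"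
    using E xy ne by (auto simp: U_def V_def)
  ultimately show False
    using K(1) unfolding connectedin by blast
qed

text \<open>Takes the place of boundary values of \<open>f\<close>: the level set of the winding
  number through \<open>x\<close> is open, hence a neighbourhood of \<open>x\<close>, and so
  \<open>f\<close> enters it arbitrarily close to \<open>E\<close>.\<close>

lemma cluster_set_winding_number:
  assumes \<gamma>: "path \<gamma>" "pathfinish \<gamma> = pathstart \<gamma>"
    and x: "x \<in> cluster_set f S E" "x \<notin> Some ` path_image \<gamma>" and "0 < \<epsilon>"
  obtains z where "z \<in> S" "infdist z E < \<epsilon>" "winding_number \<gamma> (f z) = sphere_winding_number \<gamma> x"
proof -
  define L where "L = {y. y \<notin> Some ` path_image \<gamma> \<and> sphere_winding_number \<gamma> y = sphere_winding_number \<gamma> x}"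
  have "x \<in> riemann_sphere closure_of (Some ` f ` {z \<in> S. infdist z E < \<epsilon>})"
    using x(1) \<open>0 < \<epsilon>\<close> by (auto simp: cluster_set_def)
  moreover have "openin riemann_sphere L" "x \<in> L"
    using openin_sphere_winding_number_level[OF \<gamma>] x(2) by (auto simp: L_def)
  ultimately obtain y where "y \<in> Some ` f ` {z \<in> S. infdist z E < \<epsilon>}" "y \<in> L"
    unfolding in_closure_of by metis
  then show ?thesis
    using that by (auto simp: L_def sphere_winding_number_def)
qed

lemma abs_cmod_diff_le_infdist_sphere:
  assumes "0 \<le> r"
  shows "\<bar>cmod z - r\<bar> \<le> infdist z (sphere 0 r)"
proof -
  have "sphere (0::complex) r \<noteq> {}" using assms by simp
  then obtain y where "y \<in> sphere 0 r" "infdist z (sphere 0 r) = dist z y"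
    using infdist_attains_inf[of "sphere 0 r" z] by auto
  then show ?thesis
    using norm_triangle_ineq3[of z y] by (auto simp: dist_norm)
qed

lemma complementary_componentD:
  assumes "K \<in> complementary_components A"
  shows "connectedin riemann_sphere K" "K \<inter> A = {}"
  using connectedin_connected_components_of[OF assms[unfolded complementary_components_def]]
  by (auto simp: connectedin_subtopology)

lemma has_contour_integral_log_deriv_annulus:
  assumes ab: "0 < a" "a < r" "r < b"
    and f: "f holomorphic_on open_annulus a b" "inj_on f (open_annulus a b)"
    and D: "Some 0 \<in> D" and E: "None \<in> E"
    and inner: "boundary_component_facing (Some ` f ` open_annulus a b) D
        (cluster_set f (open_annulus a b) (sphere 0 a))"
    and outer: "boundary_component_facing (Some ` f ` open_annulus a b) E
        (cluster_set f (open_annulus a b) (sphere 0 b))"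
  shows "((\<lambda>z. deriv f z / f z) has_contour_integral 2 * pi * \<i>) (circlepath 0 r)"
proof -
  let ?S = "open_annulus a b" and ?\<gamma> = "f \<circ> circlepath 0 r"
  have sub: "path_image (circlepath 0 r) \<subseteq> ?S"
    by (rule path_image_circlepath_open_annulus[OF ab])
  have path: "path ?\<gamma>" "pathfinish ?\<gamma> = pathstart ?\<gamma>"
    by (auto intro!: path_continuous_image holomorphic_on_imp_continuous_on holomorphic_on_subset[OF f(1) sub]
       simp: path_circlepath pathfinish_compose pathstart_compose)
  have \<gamma>A: "Some ` path_image ?\<gamma> \<subseteq> Some ` f ` ?S"
    using sub by (auto simp: path_image_compose)
  have ne: "B \<noteq> {}" if "boundary_component_facing X Y B" for X Y B
    using that nonempty_connected_components_of unfolding boundary_component_facing_def by blast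
  obtain K where K: "K \<in> complementary_components (Some ` f ` ?S)" "D \<subseteq> K" "cluster_set f ?S (sphere 0 a) \<subseteq> K"
    using inner unfolding boundary_component_facing_def by blast
  obtain L where L: "L \<in> complementary_components (Some ` f ` ?S)" "E \<subseteq> L" "cluster_set f ?S (sphere 0 b) \<subseteq> L"
    using outer unfolding boundary_component_facing_def by blast
  \<comment> \<open>A boundary component is a connected component and hence nonempty, so both
    cluster sets have points: \<open>p\<close> shares a complementary component with 0, and
    \<open>q\<close> shares one with infinity.\<close>
  obtain p where p: "p \<in> cluster_set f ?S (sphere 0 a)" using ne[OF inner] by blast
  obtain q where q: "q \<in> cluster_set f ?S (sphere 0 b)" using ne[OF outer] by blast
  note cK = complementary_componentD[OF K(1)] and cL = complementary_componentD[OF L(1)]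
  have mem: "p \<in> K" "Some 0 \<in> K" "q \<in> L" "None \<in> L"
    using p q K(2,3) L(2,3) D E by blast+
  have disj: "K \<inter> Some ` path_image ?\<gamma> = {}" "L \<inter> Some ` path_image ?\<gamma> = {}"
    using Int_mono[OF order_refl \<gamma>A] cK(2) cL(2) by (metis subset_empty)+
  have "sphere_winding_number ?\<gamma> p = sphere_winding_number ?\<gamma> (Some 0)"
    by (rule sphere_winding_number_constant[OF path cK(1) disj(1) mem(1,2)])
  then have p0: "sphere_winding_number ?\<gamma> p = winding_number ?\<gamma> 0"
    by (simp add: sphere_winding_number_def)
  have "sphere_winding_number ?\<gamma> q = sphere_winding_number ?\<gamma> None"
    by (rule sphere_winding_number_constant[OF path cL(1) disj(2) mem(3,4)])
  then have q0: "sphere_winding_number ?\<gamma> q = 0"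
    by (simp add: sphere_winding_number_def)
  have pq: "p \<notin> Some ` path_image ?\<gamma>" "q \<notin> Some ` path_image ?\<gamma>"
    using disj mem by (metis IntI empty_iff)+
  \<comment> \<open>The distances \<open>r - a\<close> here and \<open>b - r\<close> below force
    |z1| < r < |z2|.\<close>
  obtain z1 where z1: "z1 \<in> ?S" "infdist z1 (sphere 0 a) < r - a" "winding_number ?\<gamma> (f z1) = winding_number ?\<gamma> 0"
    using cluster_set_winding_number[OF path p pq(1), of "r - a"] ab p0 by auto
  obtain z2 where z2: "z2 \<in> ?S" "infdist z2 (sphere 0 b) < b - r" "winding_number ?\<gamma> (f z2) = 0"
    using cluster_set_winding_number[OF path q pq(2), of "b - r"] ab q0 by auto
  have "cmod z1 < r" "r < cmod z2" "a < cmod z1" "cmod z2 < b"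
    using abs_cmod_diff_le_infdist_sphere[of a z1] abs_cmod_diff_le_infdist_sphere[of b z2] z1 z2 ab
    by (auto simp: open_annulus_def)
  then have w1: "winding_number ?\<gamma> 0 = 1"
    using winding_number_annulus_image_jump[OF ab(1) f, of z1 r z2] z1(3) z2(3) by simp
  have 0: "0 \<notin> f ` ?S" using cK(2) K D by auto
  then have "contour_integral (circlepath 0 r) (\<lambda>z. deriv f z / (f z - 0)) = 2 * pi * \<i>"
    using winding_number_comp_circlepath[OF ab f(1), of 0] sub ab w1 by auto
  moreover have "(\<lambda>z. deriv f z / (f z - 0)) contour_integrable_on circlepath 0 r"
    using 0 f(1)
    by (intro contour_integrable_holomorphic_simple[OF _ open_open_annulus _ sub] holomorphic_intros holomorphic_deriv) auto
  ultimately have "((\<lambda>z. deriv f z / (f z - 0)) has_contour_integral 2 * pi * \<i>) (circlepath 0 r)"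
    using has_contour_integral_integral by metis
  then show ?thesis by simp
qed

section \<open>Discs around infinity\<close>

text \<open>Inversion in source and target turns \<open>f\<close> into a univalent map of the unit
  disc fixing 0: \<open>nz\<close> excludes poles, and the limit of \<open>f\<close> at infinity
  removes the singularity at 0. The squared modulus of the factor 1 / z^2 in the last claim is the
  Jacobian of the inversion, so defect integrals are unchanged.\<close>

lemma univalent_exterior_inversion:
  assumes f: "univalent_exterior f" and nz: "0 \<notin> f ` exterior_disc"
    and F_def: "F = (\<lambda>z. if z = 0 then 0 else 1 / f (1 / z))"
  shows "F holomorphic_on ball 0 1" "inj_on F (ball 0 1)" "deriv_infinity f = 1 / deriv F 0"
    and "F ` ball 0 1 - {0} = (\<lambda>w. 1 / w) ` f ` exterior_disc"
    and "\<And>z. z \<in> ball 0 1 - {0} \<Longrightarrow>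
      deriv F z / F z - 1 / z = (deriv f (1 / z) / f (1 / z) - 1 / (1 / z)) / z\<^sup>2"
proof -
  have hol: "f holomorphic_on exterior_disc" and inj: "inj_on f exterior_disc"
    and lim: "filterlim f at_infinity at_infinity"
    using f by (auto simp: univalent_exterior_def univalent_on_def)
  have oE: "open exterior_disc"
    unfolding exterior_disc_def by (intro open_Collect_less continuous_intros)
  have inv: "1 / z \<in> exterior_disc" if "z \<in> ball 0 1 - {0}" for z
    using that by (auto simp: exterior_disc_def norm_divide)
  have inv': "1 / z \<in> ball 0 1 - {0}" if "z \<in> exterior_disc" for z
    using that by (auto simp: exterior_disc_def norm_divide divide_less_eq_1)
  have nz': "f (1 / z) \<noteq> 0" if "z \<in> ball 0 1 - {0}" for z
    using inv[OF that] nz by (metis imageI)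
  have "(\<lambda>z. f (1 / z)) holomorphic_on ball 0 1 - {0}"
  proof (rule holomorphic_on_compose_gen[OF _ hol, unfolded o_def])
    show "(\<lambda>z. 1 / z) ` (ball 0 1 - {0}) \<subseteq> exterior_disc"
      using inv by blast
  qed (auto intro!: holomorphic_intros)
  then have hol1: "(\<lambda>z. 1 / f (1 / z)) holomorphic_on ball 0 1 - {0}"
    using nz' by (intro holomorphic_intros)
  have hol2: "F holomorphic_on ball 0 1 - {0}"
    by (rule holomorphic_transform[OF hol1]) (auto simp: F_def)
  have lim0: "filterlim (\<lambda>z. f (1 / z)) at_infinity (at 0)"
    using filterlim_compose[OF lim filterlim_inverse_at_infinity]
    by (simp add: field_simps inverse_eq_divide)
  have "((\<lambda>z. 1 / f (1 / z)) \<longlongrightarrow> 0) (at 0)"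
    using filterlim_compose[OF tendsto_inverse_0 lim0] by (simp add: inverse_eq_divide)
  then have "(F \<longlongrightarrow> 0) (at 0)"
    by (rule Lim_transform_eventually) (auto simp: F_def eventually_at_filter)
  then have "(F \<longlongrightarrow> F 0) (at 0)"
    by (simp add: F_def)
  then show hF: "F holomorphic_on ball 0 1"
    using at_within_open[of "0::complex" "ball 0 1"]
    by (intro no_isolated_singularity'[OF _ hol2]) simp_all
  show injF: "inj_on F (ball 0 1)"
  proof (rule inj_onI)
    fix x y assume xy: "x \<in> ball 0 1" "y \<in> ball 0 1" "F x = F y"
    show "x = y"
    proof (cases "x = 0 \<or> y = 0")
      case True
      then show ?thesis using xy nz'[of x] nz'[of y] by (auto simp: F_def split: if_splits)
    next
      case False
      then have "f (1 / x) = f (1 / y)" using xy by (auto simp: F_def)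
      then have "1 / x = 1 / y"
        using inj_onD[OF inj _ inv inv] xy False by simp
      then show ?thesis by simp
    qed
  qed
  have d0: "deriv F 0 \<noteq> 0"
    using holomorphic_injective_imp_regular[OF hF open_ball injF] by simp
  have "(F has_field_derivative deriv F 0) (at 0)"
    by (intro holomorphic_derivI[OF hF]) auto
  then have "((\<lambda>z. F z / z) \<longlongrightarrow> deriv F 0) (at 0)"
    by (simp add: has_field_derivative_iff F_def)
  \<comment> \<open>Under z = 1 / w the quotient F z / z becomes w / f w, whose reciprocal is the
    quotient in \<open>deriv_infinity\<close>.\<close>
  then have "((\<lambda>z. inverse (F z / z)) \<longlongrightarrow> inverse (deriv F 0)) (at 0)"
    using d0 by (rule tendsto_inverse)
  from filterlim_compose[OF this, of inverse at_infinity]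
  have "((\<lambda>w. inverse (F (inverse w) / inverse w)) \<longlongrightarrow> inverse (deriv F 0)) at_infinity"
    using filterlim_inverse_at_iff[of "\<lambda>w. w" "at_infinity :: complex filter"]
    by (simp add: filterlim_ident)
  then have "((\<lambda>w. f w / w) \<longlongrightarrow> inverse (deriv F 0)) at_infinity"
  proof (rule Lim_transform_eventually)
    have "eventually (\<lambda>w::complex. w \<noteq> 0) at_infinity"
      unfolding eventually_at_infinity by (rule exI[of _ 1]) auto
    then show "eventually (\<lambda>w. inverse (F (inverse w) / inverse w) = f w / w) at_infinity"
      by eventually_elim (simp add: F_def inverse_eq_divide)
  qed
  then show "deriv_infinity f = 1 / deriv F 0"
    unfolding deriv_infinity_def by (simp add: tendsto_Lim[OF trivial_limit_at_infinity] inverse_eq_divide)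
  show "F ` ball 0 1 - {0} = (\<lambda>w. 1 / w) ` f ` exterior_disc"
  proof (intro equalityI subsetI)
    fix w assume "w \<in> F ` ball 0 1 - {0}"
    then obtain z where z: "z \<in> ball 0 1" "w = F z" "w \<noteq> 0" by auto
    then have "z \<noteq> 0" by (auto simp: F_def)
    then have "w = 1 / f (1 / z)" using z by (simp add: F_def)
    then show "w \<in> (\<lambda>w. 1 / w) ` f ` exterior_disc"
      using inv[of z] z \<open>z \<noteq> 0\<close> by auto
  next
    fix w assume "w \<in> (\<lambda>w. 1 / w) ` f ` exterior_disc"
    then obtain z where z: "z \<in> exterior_disc" "w = 1 / f z" by auto
    then have "w = F (1 / z)" "w \<noteq> 0" using inv'[of z] nz by (auto simp: F_def)
    then show "w \<in> F ` ball 0 1 - {0}" using inv'[of z] z by auto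
  qed
  fix z :: complex assume z: "z \<in> ball 0 1 - {0}"
  then have "z \<noteq> 0" by auto
  have df: "(f has_field_derivative deriv f (1 / z)) (at (1 / z))"
    by (rule holomorphic_derivI[OF hol oE inv[OF z]])
  have "((\<lambda>z. 1 / z) has_field_derivative - 1 / z\<^sup>2) (at z)"
    using \<open>z \<noteq> 0\<close> by (auto intro!: derivative_eq_intros simp: power2_eq_square field_simps)
  from DERIV_chain2[OF df this]
  have "((\<lambda>z. f (1 / z)) has_field_derivative deriv f (1 / z) * (- 1 / z\<^sup>2)) (at z)" .
  then have "((\<lambda>z. 1 / f (1 / z)) has_field_derivative (deriv f (1 / z) / z\<^sup>2) / (f (1 / z))\<^sup>2) (at z)"
    using nz'[OF z] by (auto intro!: derivative_eq_intros simp: power2_eq_square field_simps)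
  moreover have "eventually (\<lambda>x. 1 / f (1 / x) = F x) (nhds z)"
    using t1_space_nhds[OF \<open>z \<noteq> 0\<close>] by eventually_elim (simp add: F_def)
  ultimately have "(F has_field_derivative (deriv f (1 / z) / z\<^sup>2) / (f (1 / z))\<^sup>2) (at z)"
    using DERIV_cong_ev[of z z "\<lambda>x. 1 / f (1 / x)" F, OF refl _ refl] by simp
  then have "deriv F z = (deriv f (1 / z) / z\<^sup>2) / (f (1 / z))\<^sup>2"
    by (rule DERIV_imp_deriv)
  then show "deriv F z / F z - 1 / z = (deriv f (1 / z) / f (1 / z) - 1 / (1 / z)) / z\<^sup>2"
    using \<open>z \<noteq> 0\<close> nz'[OF z] by (simp add: F_def power2_eq_square field_simps)
qed

lemma
  fixes k :: "complex \<Rightarrow> real"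
  assumes "open S" "0 \<notin> S" and k: "continuous_on ((\<lambda>z. 1 / z) ` S) k"
  shows set_integrable_inversion:
      "set_integrable lborel ((\<lambda>z. 1 / z) ` S) k \<longleftrightarrow> set_integrable lborel S (\<lambda>z. k (1 / z) / (cmod z) ^ 4)"
    and set_integral_inversion:
      "(LINT w:(\<lambda>z. 1 / z) ` S|lborel. k w) = (LINT z:S|lborel. k (1 / z) / (cmod z) ^ 4)"
proof -
  have hol: "(\<lambda>z. 1 / z) holomorphic_on S"
    using assms(2) by (intro holomorphic_intros) auto
  have inj: "inj_on (\<lambda>z::complex. 1 / z) S" by (auto simp: inj_on_def)
  have eq: "(cmod (deriv (\<lambda>z. 1 / z) z))\<^sup>2 * k (1 / z) = k (1 / z) / (cmod z) ^ 4" if "z \<in> S" for z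
  proof -
    have "z \<noteq> 0" using that assms(2) by auto
    then have "((\<lambda>z. 1 / z) has_field_derivative - 1 / z\<^sup>2) (at z)"
      by (auto intro!: derivative_eq_intros simp: power2_eq_square field_simps)
    then have "deriv (\<lambda>z. 1 / z) z = - 1 / z\<^sup>2" by (rule DERIV_imp_deriv)
    then show ?thesis
      by (simp add: norm_divide norm_power power_divide flip: power_mult)
  qed
  show "set_integrable lborel ((\<lambda>z. 1 / z) ` S) k \<longleftrightarrow> set_integrable lborel S (\<lambda>z. k (1 / z) / (cmod z) ^ 4)"
    unfolding set_integrable_holomorphic_image[OF \<open>open S\<close> hol inj k]
    by (rule set_integrable_cong) (use eq in auto)
  show "(LINT w:(\<lambda>z. 1 / z) ` S|lborel. k w) = (LINT z:S|lborel. k (1 / z) / (cmod z) ^ 4)"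
    unfolding set_integral_holomorphic_image[OF \<open>open S\<close> hol inj k]
    by (rule set_lebesgue_integral_cong) (use eq \<open>open S\<close> in auto)
qed

text \<open>Inversion is an isometry of |dw| / |w|: the density |z|^2 at the point 1 / z times the
  Jacobian 1 / |z|^4 is 1 / |z|^2.\<close>

lemma log_area_inversion:
  assumes "open S" "0 \<notin> S"
  shows "log_area ((\<lambda>z. 1 / z) ` S) = log_area S"
proof -
  have "continuous_on ((\<lambda>z. 1 / z) ` S) (\<lambda>w. 1 / (cmod w)\<^sup>2)"
    using assms by (intro continuous_intros) auto
  then have "log_area ((\<lambda>z. 1 / z) ` S) = (LINT z:S|lborel. (1 / (cmod (1 / z))\<^sup>2) / (cmod z) ^ 4)"
    unfolding log_area_def by (rule set_integral_inversion[OF assms])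
  also have "\<dots> = log_area S"
    unfolding log_area_def
    by (rule set_lebesgue_integral_cong)
      (use assms in \<open>auto simp: norm_divide power_divide power2_eq_square power4_eq_xxxx divide_simps\<close>)
  finally show ?thesis .
qed

text \<open>The disc formula removes an open ball, whereas inversion of an open set and the
  partition of an open annulus call for removing a closed one. The circle in between is a null
  set.\<close>

lemma log_area_Diff_ball:
  assumes "S \<in> sets borel"
  shows "log_area (S - ball 0 s) = log_area (S - cball 0 s)"
proof -
  have m: "(\<lambda>w::complex. indicator T w *\<^sub>R (1 / (cmod w)\<^sup>2)) \<in> borel_measurable lborel" if "T \<in> sets borel" for T
    using that by (intro borel_measurable_scaleR borel_measurable_indicator) simp_all
  have "sphere (0::complex) s \<in> null_sets lborel"
    using negligible_sphere[of "0::complex" s]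
    by (metis borel_closed closed_sphere negligible_iff_null_sets null_sets_completion_iff sets_lborel)
  then have "AE w in lborel. w \<notin> sphere (0::complex) s"
    by (rule AE_not_in)
  then have "AE w in lborel. indicat_real (S - ball 0 s) w *\<^sub>R (1 / (cmod w)\<^sup>2)
      = indicat_real (S - cball 0 s) w *\<^sub>R (1 / (cmod w)\<^sup>2)"
    by eventually_elim (auto simp: indicator_def)
  then show ?thesis
    unfolding log_area_def set_lebesgue_integral_def
    using assms by (intro integral_cong_AE m) auto
qed

text \<open>The disc formula is applied to F(z) = 1 / f(1 / z) with \<rho> = 1 and reference radius
  1 / R. Inversion takes what remains of the image of F to the part of the image of \<open>f\<close>
  in \<open>ball 0 R\<close>, up to a circle. By \<open>avoid\<close> the image of F is bounded by 1
  / s, which gives the integrability required there.\<close>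

lemma
  assumes f: "univalent_exterior f" and s: "0 < s" "s < R"
    and avoid: "\<And>w. w \<in> f ` exterior_disc \<Longrightarrow> s \<le> cmod w"
    and R: "- ball 0 R \<subseteq> f ` exterior_disc"
  shows set_integrable_defect_exterior: "set_integrable lborel exterior_disc (log_deriv_defect f)"
    and set_integral_defect_exterior: "(LINT z:exterior_disc|lborel. log_deriv_defect f z) =
           log_area (f ` exterior_disc \<inter> ball 0 R) + 2 * pi * ln (cmod (deriv_infinity f) / R)"
    and deriv_infinity_nonzero: "deriv_infinity f \<noteq> 0"
proof -
  let ?E = "f ` exterior_disc"
  have nz: "0 \<notin> ?E" using avoid[of 0] s by auto
  define F where "F = (\<lambda>z. if z = 0 then 0 else 1 / f (1 / z))"
  note F = univalent_exterior_inversion[OF f nz F_def]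
  have hol: "f holomorphic_on exterior_disc" and inj: "inj_on f exterior_disc"
    using f by (auto simp: univalent_exterior_def univalent_on_def)
  have oE: "open exterior_disc"
    unfolding exterior_disc_def by (intro open_Collect_less continuous_intros)
  have F0: "F 0 = 0" by (simp add: F_def)
  let ?G = "F ` ball 0 1"
  have G: "?G - {0} = (\<lambda>w. 1 / w) ` ?E" by (rule F(4))
  have oG: "open ?G" by (intro open_mapping_thm3 F) auto
  have memG: "w \<in> ?G \<longleftrightarrow> 1 / w \<in> ?E" if "w \<noteq> 0" for w
  proof -
    have "w \<in> ?G \<longleftrightarrow> w \<in> (\<lambda>w. 1 / w) ` ?E" using that G by blast
    also have "\<dots> \<longleftrightarrow> 1 / w \<in> ?E"
    proof
      assume "1 / w \<in> ?E"
      then show "w \<in> (\<lambda>w. 1 / w) ` ?E" by (rule rev_image_eqI) simp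
    qed auto
    finally show ?thesis .
  qed
  have d0: "deriv F 0 \<noteq> 0"
    using holomorphic_injective_imp_regular[OF F(1) open_ball F(2)] by simp
  then show "deriv_infinity f \<noteq> 0" using F(3) by simp
  have R0: "0 < R" using s by simp
  have cb: "cball 0 (1 / R) \<subseteq> ?G"
  proof
    fix w :: complex assume w: "w \<in> cball 0 (1 / R)"
    show "w \<in> ?G"
    proof (cases "w = 0")
      case True
      then show ?thesis using F0 by (auto intro!: image_eqI[of _ _ 0])
    next
      case False
      then have "R \<le> cmod (1 / w)" using w R0 by (simp add: norm_divide field_simps)
      then have "1 / w \<in> ?E" using R by (auto simp: subset_iff)
      then show ?thesis using memG[OF False] by simp
    qed
  qed
  have bG: "cmod w \<le> 1 / s" if "w \<in> ?G" for w
  proof (cases "w = 0")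
    case False
    then have "s \<le> cmod (1 / w)" using memG that avoid by blast
    then show ?thesis using False s by (simp add: norm_divide field_simps)
  qed (use s in auto)
  have int: "set_integrable lborel (?G - ball 0 (1 / R)) (\<lambda>w. 1 / (cmod w)\<^sup>2)"
    by (rule set_integrable_inverse_square[of _ "1 / R"])
      (use oG bG R0 in \<open>auto intro!: boundedI[of _ "1 / s"]\<close>)
  have b: "ball 0 (1 / R) \<subseteq> ?G" using cb by auto
  have Rp: "0 < 1 / R" using R0 by simp
  note I1 = set_integrable_defect_disc[OF zero_less_one F(1,2) F0 Rp b int]
    and I2 = set_integral_defect_disc[OF zero_less_one F(1,2) F0 Rp b int]
  have X: "log_area (?G - ball 0 (1 / R)) = log_area (?E \<inter> ball 0 R)"
  proof -
    have "?E \<inter> ball 0 R = (\<lambda>w. 1 / w) ` (?G - cball 0 (1 / R))"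
    proof (intro equalityI subsetI)
      fix w assume w: "w \<in> ?E \<inter> ball 0 R"
      then have "w \<noteq> 0" using nz by auto
      then have "1 / w \<in> ?G - cball 0 (1 / R)"
        using w memG[of "1 / w"] R0 by (auto simp: norm_divide field_simps)
      then show "w \<in> (\<lambda>w. 1 / w) ` (?G - cball 0 (1 / R))"
        by (intro image_eqI[of _ _ "1 / w"]) auto
    next
      fix w assume "w \<in> (\<lambda>w. 1 / w) ` (?G - cball 0 (1 / R))"
      then obtain v where "v \<in> ?G - cball 0 (1 / R)" and "w = 1 / v" by blast
      then have v: "v \<in> ?G" "\<not> cmod v \<le> 1 / R" "w = 1 / v" by auto
      then have "v \<noteq> 0" using Rp by auto
      then have "w \<in> ?E" using v memG by blast
      moreover have "cmod w < R"
        using v(2) R0 \<open>v \<noteq> 0\<close> unfolding v(3) by (simp add: norm_divide field_simps)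
      ultimately show "w \<in> ?E \<inter> ball 0 R" by simp
    qed
    then have "log_area (?E \<inter> ball 0 R) = log_area (?G - cball 0 (1 / R))"
      using oG R0 by (simp add: log_area_inversion open_Diff)
    then show ?thesis using oG by (simp add: log_area_Diff_ball)
  qed
  have img: "exterior_disc = (\<lambda>z. 1 / z) ` (ball 0 1 - {0})"
  proof (intro equalityI subsetI)
    fix w assume "w \<in> exterior_disc"
    then show "w \<in> (\<lambda>z. 1 / z) ` (ball 0 1 - {0})"
      by (intro image_eqI[of _ _ "1 / w"]) (auto simp: exterior_disc_def norm_divide divide_less_eq_1)
  qed (auto simp: exterior_disc_def norm_divide less_divide_eq_1)
  have k: "continuous_on exterior_disc (log_deriv_defect f)"
    unfolding log_deriv_defect_def using nz hol oE
    by (intro continuous_intros holomorphic_on_imp_continuous_on holomorphic_deriv)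
      (auto simp: exterior_disc_def)
  have op: "open (ball 0 1 - {0::complex})" "(0::complex) \<notin> ball 0 1 - {0}" by auto
  have eq: "log_deriv_defect f (1 / z) / (cmod z) ^ 4 = log_deriv_defect F z" if "z \<in> ball 0 1 - {0}" for z
    unfolding log_deriv_defect_def F(5)[OF that]
    by (simp add: norm_divide norm_power power_divide flip: power_mult)
  \<comment> \<open>By the convention x / 0 = 0 the defect of \<open>F\<close> vanishes at 0, so
    filling in the puncture changes nothing pointwise.\<close>
  have ind: "indicator (ball 0 1 - {0}) z *\<^sub>R log_deriv_defect F z = indicator (ball 0 1) z *\<^sub>R log_deriv_defect F z" for z
    using F0 by (auto simp: indicator_def log_deriv_defect_def)
  have "set_integrable lborel exterior_disc (log_deriv_defect f) \<longleftrightarrow>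
      set_integrable lborel (ball 0 1 - {0}) (\<lambda>z. log_deriv_defect f (1 / z) / (cmod z) ^ 4)"
    using set_integrable_inversion[OF op, folded img, OF k] .
  also have "\<dots> \<longleftrightarrow> set_integrable lborel (ball 0 1 - {0}) (log_deriv_defect F)"
    by (rule set_integrable_cong) (use eq in auto)
  also have "\<dots> \<longleftrightarrow> set_integrable lborel (ball 0 1) (log_deriv_defect F)"
    unfolding set_integrable_def ind ..
  finally show "set_integrable lborel exterior_disc (log_deriv_defect f)"
    using I1 by simp
  have "(LINT z:exterior_disc|lborel. log_deriv_defect f z)
      = (LINT z:ball 0 1 - {0}|lborel. log_deriv_defect f (1 / z) / (cmod z) ^ 4)"
    using set_integral_inversion[OF op, folded img, OF k] .
  also have "\<dots> = (LINT z:ball 0 1 - {0}|lborel. log_deriv_defect F z)"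
    by (rule set_lebesgue_integral_cong) (use eq in auto)
  also have "\<dots> = (LINT z:ball 0 1|lborel. log_deriv_defect F z)"
    unfolding set_lebesgue_integral_def ind ..
  finally show "(LINT z:exterior_disc|lborel. log_deriv_defect f z) =
           log_area (?E \<inter> ball 0 R) + 2 * pi * ln (cmod (deriv_infinity f) / R)"
    unfolding I2 X F(3) by (simp add: norm_divide mult.commute)
qed

lemma exterior_image_contains_nhd_infinity:
  assumes "univalent_exterior f" "0 \<notin> f ` exterior_disc"
  obtains R where "0 < R" "- ball 0 R \<subseteq> f ` exterior_disc"
proof -
  define F where "F = (\<lambda>z. if z = 0 then 0 else 1 / f (1 / z))"
  note F = univalent_exterior_inversion[OF assms F_def]
  have "open (F ` ball 0 1)" by (intro open_mapping_thm3 F) auto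
  moreover have "0 \<in> F ` ball 0 1" by (auto simp: F_def intro!: image_eqI[of _ _ 0])
  ultimately obtain e where e: "0 < e" "cball 0 e \<subseteq> F ` ball 0 1"
    using open_contains_cball by blast
  have "w \<in> f ` exterior_disc" if "w \<notin> ball 0 (1 / e)" for w
  proof -
    have "1 / e \<le> cmod w" "0 < 1 / e" using that e(1) by auto
    then have "0 < cmod w" by linarith
    then have "1 / w \<noteq> 0" "cmod (1 / w) \<le> e"
      using \<open>1 / e \<le> cmod w\<close> e(1) by (auto simp: norm_divide field_simps)
    then have "1 / w \<in> F ` ball 0 1 - {0}" using e(2) by (auto simp: subset_iff)
    then obtain v where "v \<in> f ` exterior_disc" "1 / w = 1 / v" unfolding F(4) by blast
    then show ?thesis by simp
  qed
  then have "- ball 0 (1 / e) \<subseteq> f ` exterior_disc" by blast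
  then show ?thesis using that[of "1 / e"] e(1) by simp
qed

text \<open>The density is positive except at 0, where the convention 1 / 0 = 0 makes it vanish;
  this is why 0 is kept out of \<open>S\<close>.\<close>

lemma log_area_eq_0_iff:
  assumes "set_integrable lborel S (\<lambda>w. 1 / (cmod w)\<^sup>2)" "S \<in> sets borel" "0 \<notin> S"
  shows "log_area S = 0 \<longleftrightarrow> S \<in> null_sets lborel"
proof -
  have "log_area S = 0 \<longleftrightarrow> (AE w in lborel. indicator S w *\<^sub>R (1 / (cmod w)\<^sup>2) = 0)"
    using assms(1) unfolding log_area_def set_lebesgue_integral_def set_integrable_def
    by (intro integral_nonneg_eq_0_iff_AE) auto
  also have "\<dots> \<longleftrightarrow> (AE w in lborel. w \<notin> S)"
    by (intro AE_cong) (use assms(3) in \<open>auto simp: indicator_def\<close>)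
  also have "\<dots> \<longleftrightarrow> S \<in> null_sets lborel"
    using assms(2) by (simp add: AE_iff_null_sets)
  finally show ?thesis .
qed

section \<open>The multiple Grunsky inequality\<close>

theorem proposition3p3:
  fixes \<tau> :: real
    and f\<^sub>1 f\<^sub>A f\<^sub>2 :: "complex \<Rightarrow> complex"
    and D\<^sub>1 A D\<^sub>2 :: "complex option set"
  assumes "\<tau> > 0"
    and "univalent_on f\<^sub>1 (ball 0 (exp (- 2 * pi * \<tau>)))"
    and "univalent_on f\<^sub>A (annulus \<tau>)"
    and "univalent_exterior f\<^sub>2"
    and "D\<^sub>1 = Some ` f\<^sub>1 ` ball 0 (exp (- 2 * pi * \<tau>))"
    and "A = Some ` f\<^sub>A ` annulus \<tau>"
    and "D\<^sub>2 = insert None (Some ` f\<^sub>2 ` exterior_disc)"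
    and "D\<^sub>1 \<inter> A = {}" and "D\<^sub>1 \<inter> D\<^sub>2 = {}" and "A \<inter> D\<^sub>2 = {}"
    and "f\<^sub>1 0 = 0"
    and "separates A D\<^sub>1 D\<^sub>2"
    and "boundary_component_facing A D\<^sub>1
           (cluster_set f\<^sub>A (annulus \<tau>) (sphere 0 (exp (- 2 * pi * \<tau>))))"
    and "boundary_component_facing A D\<^sub>2
           (cluster_set f\<^sub>A (annulus \<tau>) (sphere 0 1))"
  shows "set_integrable lborel (ball 0 (exp (- 2 * pi * \<tau>))) (log_deriv_defect f\<^sub>1) \<and>
    set_integrable lborel (annulus \<tau>) (log_deriv_defect f\<^sub>A) \<and>
    set_integrable lborel exterior_disc (log_deriv_defect f\<^sub>2) \<and>
    (LINT z:ball 0 (exp (- 2 * pi * \<tau>))|lborel. log_deriv_defect f\<^sub>1 z)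
      + (LINT z:annulus \<tau>|lborel. log_deriv_defect f\<^sub>A z)
      + (LINT z:exterior_disc|lborel. log_deriv_defect f\<^sub>2 z)
      \<le> 2 * pi * ln (cmod (deriv_infinity f\<^sub>2 / deriv f\<^sub>1 0)) \<and>
    ((LINT z:ball 0 (exp (- 2 * pi * \<tau>))|lborel. log_deriv_defect f\<^sub>1 z)
      + (LINT z:annulus \<tau>|lborel. log_deriv_defect f\<^sub>A z)
      + (LINT z:exterior_disc|lborel. log_deriv_defect f\<^sub>2 z)
      = 2 * pi * ln (cmod (deriv_infinity f\<^sub>2 / deriv f\<^sub>1 0))
     \<longleftrightarrow> {z. Some z \<notin> D\<^sub>1 \<union> A \<union> D\<^sub>2} \<in> null_sets lborel)"
proof -
  let ?\<rho> = "exp (- 2 * pi * \<tau>)" and ?I = "\<lambda>w::complex. 1 / (cmod w)\<^sup>2"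
  define G where "G = f\<^sub>1 ` ball 0 ?\<rho>"
  define H where "H = f\<^sub>A ` open_annulus ?\<rho> 1"
  define E where "E = f\<^sub>2 ` exterior_disc"
  \<comment> \<open>Infinity lies in \<open>D\<^sub>2\<close>, so these finite points form the whole
    complement in the sphere.\<close>
  define N where "N = {z. Some z \<notin> D\<^sub>1 \<union> A \<union> D\<^sub>2}"
  have \<rho>: "0 < ?\<rho>" "?\<rho> < 1" using \<open>\<tau> > 0\<close> by auto
  have ann: "annulus \<tau> = open_annulus ?\<rho> 1" by (simp add: annulus_def open_annulus_def)
  have f1: "f\<^sub>1 holomorphic_on ball 0 ?\<rho>" "inj_on f\<^sub>1 (ball 0 ?\<rho>)"
    and fA: "f\<^sub>A holomorphic_on open_annulus ?\<rho> 1" "inj_on f\<^sub>A (open_annulus ?\<rho> 1)"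
    and f2: "f\<^sub>2 holomorphic_on exterior_disc" "inj_on f\<^sub>2 exterior_disc"
    using assms(2-4) by (auto simp: univalent_on_def univalent_exterior_def ann)
  have D1: "D\<^sub>1 = Some ` G" and A: "A = Some ` H" and D2: "D\<^sub>2 = insert None (Some ` E)"
    using assms(5-7) by (simp_all add: G_def H_def E_def ann)
  have disj: "G \<inter> H = {}" "G \<inter> E = {}" "H \<inter> E = {}"
    using assms(8-10) unfolding D1 A D2 by auto
  have N: "N = - (G \<union> H \<union> E)" unfolding N_def D1 A D2 by auto
  have 0: "0 \<in> G" unfolding G_def using \<rho> \<open>f\<^sub>1 0 = 0\<close> by (auto intro!: image_eqI[of _ _ 0])
  have oE: "open exterior_disc"
    unfolding exterior_disc_def by (intro open_Collect_less continuous_intros)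
  have op: "open G" "open H" "open E"
    unfolding G_def H_def E_def using f1 fA f2 oE by (auto intro!: open_mapping_thm3)
  \<comment> \<open>A closed ball, so that points outside \<open>G\<close> have modulus strictly
    greater than \<open>s\<close>, as membership in \<open>open_annulus s R\<close>
    requires.\<close>
  obtain s where s: "0 < s" "cball 0 s \<subseteq> G"
    using op(1) 0 open_contains_cball by blast
  obtain R where R: "0 < R" "- ball 0 R \<subseteq> E"
    using exterior_image_contains_nhd_infinity[OF assms(4)] 0 disj unfolding E_def by blast
  have sR: "s < R"
  proof (rule ccontr)
    assume "\<not> s < R"
    then have "of_real s \<in> - ball (0::complex) R" "of_real s \<in> cball (0::complex) s" using s by auto
    then have "of_real s \<in> G \<inter> E" using s R by blast
    then show False using disj by simp
  qed
  have far: "s < cmod w" if "w \<notin> G" for w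
    using that s(2) by (auto simp: subset_iff not_le)
  have near: "cmod w < R" if "w \<notin> E" for w
    using that R(2) by (auto simp: subset_iff not_le)
  have int_ann: "set_integrable lborel (open_annulus s R) ?I"
    by (rule set_integrable_inverse_square[of _ s])
      (use s in \<open>auto simp: open_annulus_def intro!: boundedI[of _ R]\<close>)
  have int_sub: "set_integrable lborel T ?I" if "T \<in> sets borel" "T \<subseteq> open_annulus s R" for T
    using that by (intro set_integrable_subset[OF int_ann]) auto
  have sets: "G - cball 0 s \<in> sets borel" "H \<in> sets borel" "E \<inter> ball 0 R \<in> sets borel" "N \<in> sets borel"
    using op by (auto simp: N)
  have subs: "G - cball 0 s \<subseteq> open_annulus s R" "H \<subseteq> open_annulus s R"
    "E \<inter> ball 0 R \<subseteq> open_annulus s R" "N \<subseteq> open_annulus s R"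
    using far near disj unfolding disjoint_iff by (auto simp: open_annulus_def N not_le)
  note ints = int_sub[OF sets(1) subs(1)] int_sub[OF sets(2) subs(2)] int_sub[OF sets(3) subs(3)]
    int_sub[OF sets(4) subs(4)]
  \<comment> \<open>Four disjoint pieces share the area 2 pi ln (R / s); \<open>N\<close> is the one
    that none of the three integrals sees.\<close>
  have "open_annulus s R = (G - cball 0 s) \<union> (H \<union> ((E \<inter> ball 0 R) \<union> N))"
    using subs by (auto simp: N open_annulus_def)
  moreover have "log_area ((G - cball 0 s) \<union> (H \<union> ((E \<inter> ball 0 R) \<union> N)))
      = log_area (G - cball 0 s) + (log_area H + (log_area (E \<inter> ball 0 R) + log_area N))"
  proof -
    have "log_area ((E \<inter> ball 0 R) \<union> N) = log_area (E \<inter> ball 0 R) + log_area N"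
      by (rule log_area_Un[OF ints(3,4)]) (auto simp: N)
    moreover have "log_area (H \<union> ((E \<inter> ball 0 R) \<union> N)) = log_area H + log_area ((E \<inter> ball 0 R) \<union> N)"
      by (rule log_area_Un[OF ints(2) set_integrable_Un[OF ints(3,4)]]) (use sets disj in \<open>auto simp: N\<close>)
    moreover have "log_area ((G - cball 0 s) \<union> (H \<union> ((E \<inter> ball 0 R) \<union> N)))
        = log_area (G - cball 0 s) + log_area (H \<union> ((E \<inter> ball 0 R) \<union> N))"
      by (rule log_area_Un[OF ints(1) set_integrable_Un[OF ints(2) set_integrable_Un[OF ints(3,4)]]])
        (use sets disj in \<open>auto simp: N\<close>)
    ultimately show ?thesis by simp
  qed
  ultimately have total: "log_area (G - cball 0 s) + log_area H + log_area (E \<inter> ball 0 R) + log_area N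
      = 2 * pi * ln (R / s)"
    using log_area_annulus[OF s(1) sR] by simp
  have b: "ball 0 s \<subseteq> f\<^sub>1 ` ball 0 ?\<rho>" using s(2) by (auto simp: G_def)
  have int1: "set_integrable lborel (f\<^sub>1 ` ball 0 ?\<rho> - ball 0 s) ?I"
    unfolding G_def[symmetric]
    by (rule set_integrable_inverse_square[of _ s])
      (use op s near disj in \<open>auto intro!: boundedI[of _ R] less_imp_le\<close>)
  note d1 = set_integrable_defect_disc[OF \<rho>(1) f1 \<open>f\<^sub>1 0 = 0\<close> s(1) b int1]
    set_integral_defect_disc[OF \<rho>(1) f1 \<open>f\<^sub>1 0 = 0\<close> s(1) b int1, folded G_def]
  have nzA: "f\<^sub>A z \<noteq> 0" if "z \<in> open_annulus ?\<rho> 1" for z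
    using that disj 0 by (auto simp: H_def)
  have wn: "((\<lambda>z. deriv f\<^sub>A z / f\<^sub>A z) has_contour_integral 2 * pi * \<i>) (circlepath 0 r)"
    if "?\<rho> < r" "r < 1" for r
  proof (rule has_contour_integral_log_deriv_annulus[OF \<rho>(1) that fA])
    show "Some 0 \<in> D\<^sub>1" using 0 D1 by simp
    show "None \<in> D\<^sub>2" using D2 by simp
    show "boundary_component_facing (Some ` f\<^sub>A ` open_annulus ?\<rho> 1) D\<^sub>1
        (cluster_set f\<^sub>A (open_annulus ?\<rho> 1) (sphere 0 ?\<rho>))"
      using assms(13) unfolding assms(6) ann .
    show "boundary_component_facing (Some ` f\<^sub>A ` open_annulus ?\<rho> 1) D\<^sub>2
        (cluster_set f\<^sub>A (open_annulus ?\<rho> 1) (sphere 0 1))"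
      using assms(14) unfolding assms(6) ann .
  qed
  have dA: "set_integrable lborel (open_annulus ?\<rho> 1) (log_deriv_defect f\<^sub>A)"
    "(LINT z:open_annulus ?\<rho> 1|lborel. log_deriv_defect f\<^sub>A z) = log_area H - 2 * pi * ln (1 / ?\<rho>)"
    using set_integrable_defect_annulus[OF \<rho> fA] set_integral_defect_annulus[OF \<rho> fA] nzA wn ints(2)
    by (simp_all add: H_def)
  have avoid: "s \<le> cmod w" if "w \<in> f\<^sub>2 ` exterior_disc" for w
  proof -
    have "w \<notin> G" using that disj(2) unfolding E_def by blast
    then show ?thesis using far by (simp add: less_imp_le)
  qed
  have d2: "set_integrable lborel exterior_disc (log_deriv_defect f\<^sub>2)"
    "(LINT z:exterior_disc|lborel. log_deriv_defect f\<^sub>2 z)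
      = log_area (E \<inter> ball 0 R) + 2 * pi * ln (cmod (deriv_infinity f\<^sub>2) / R)"
    "deriv_infinity f\<^sub>2 \<noteq> 0"
    using set_integrable_defect_exterior[OF assms(4) s(1) sR] set_integral_defect_exterior[OF assms(4) s(1) sR]
      deriv_infinity_nonzero[OF assms(4) s(1) sR] avoid R(2) unfolding E_def by blast+
  have nz1: "deriv f\<^sub>1 0 \<noteq> 0"
    using holomorphic_injective_imp_regular[OF f1(1) open_ball f1(2)] \<rho> by simp
  \<comment> \<open>The radii \<open>s\<close> and \<open>R\<close> cancel against the area of the
    reference annulus, and \<open>?\<rho>\<close> cancels between the disc and the annulus
    \<open>annulus \<tau>\<close>.\<close>
  have logs: "ln (s / (?\<rho> * cmod (deriv f\<^sub>1 0))) - ln (1 / ?\<rho>) + ln (cmod (deriv_infinity f\<^sub>2) / R) + ln (R / s)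
      = ln (cmod (deriv_infinity f\<^sub>2 / deriv f\<^sub>1 0))"
    using nz1 d2(3) s R \<rho> by (simp add: norm_divide ln_div ln_mult del: exp_gt_zero)
  have key: "(LINT z:ball 0 ?\<rho>|lborel. log_deriv_defect f\<^sub>1 z)
      + (LINT z:annulus \<tau>|lborel. log_deriv_defect f\<^sub>A z)
      + (LINT z:exterior_disc|lborel. log_deriv_defect f\<^sub>2 z)
      = 2 * pi * ln (cmod (deriv_infinity f\<^sub>2 / deriv f\<^sub>1 0)) - log_area N"
    unfolding d1(2) ann dA(2) d2(2) logs[symmetric] distrib_left right_diff_distrib
    using total log_area_Diff_ball[of G s] op by simp
  have N0: "log_area N = 0 \<longleftrightarrow> N \<in> null_sets lborel"
    by (rule log_area_eq_0_iff[OF ints(4) sets(4)]) (use 0 in \<open>auto simp: N\<close>)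
  have "0 \<le> log_area N"
    unfolding log_area_def set_lebesgue_integral_def by (rule Bochner_Integration.integral_nonneg) auto
  with key N0 d1(1) dA(1) d2(1) show ?thesis
    unfolding N_def ann by auto
qed

end
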